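(* Let $f(x)\in\mathbb{Z}[x]$ be a monic irreducible polynomial with a complex root $\alpha$ such that $\mathbb{Q}(\alpha)/\mathbb{Q}$ is a Galois extension, and let $G=Gal(\mathbb{Q}(\alpha)/\mathbb{Q})$. Let $\chi$ be an irreducible character of $G$ of degree $1$, and let $l$ be the order of $\chi$ (so $\mathbb{Q}(\chi)=\mathbb{Q}(\zeta_l)$ for a primitive $l$-th root of unity $\zeta_l$). Then $LR(\chi)\neq\{0\}$ holds if and only if $\sum_{g\in G}\chi(g)^d g(\alpha)=0$ for every integer $d$ relatively prime to $l$. Moreover, in that case $$LR(\chi)=\Big\{\sum_{g\in G}tr_{\mathbb{Q}(\zeta_l)/\mathbb{Q}}\big(m\,\overline{\chi(g)}\big)\,g\ \Big|\ m\in\mathbb{Q}(\zeta_l)\Big\}$$ and $\dim_{\mathbb{Q}}LR(\chi)=[\mathbb{Q}(\zeta_l):\mathbb{Q}]$.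
   Context: Notation: $\mathbb{C}[G]$ is the group algebra; for $M=\sum_{g}m_g g\in\mathbb{C}[G]$ put $M[\alpha]:=\sum_g m_g g(\alpha)$. For an irreducible complex character $\chi$ of $G$, $c_\chi:=\chi(1)|G|^{-1}\sum_{g\in G}\overline{\chi(g)}g$ is the associated central idempotent, $\mathbb{Q}(\chi):=\mathbb{Q}(\{\chi(g)\mid g\in G\})$, $Gal(\chi):=Gal(\mathbb{Q}(\chi)/\mathbb{Q})$, for $\sigma\in Gal(\chi)$ the character $\sigma(\chi)$ is $g\mapsto\sigma(\chi(g))$, and $C(\chi):=\sum_{\sigma\in Gal(\chi)}c_{\sigma(\chi)}\in\mathbb{Q}[G]$. Define $LR(\chi):=\{M\in\mathbb{Q}[G]\mid M=MC(\chi),\ M\cdot\big(\sum_{g\in G}g(\alpha)g^{-1}\big)=0\}$, where the product is taken in $\mathbb{C}[G]$. *)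

theory Defs
  imports
    "HOL-Library.Function_Algebras"
    "HOL-Computational_Algebra.Computational_Algebra"
    "HOL-Algebra.Bij"
    "HOL-Algebra.Generated_Fields"
    "Jordan_Normal_Form.VS_Connect"
begin

section \<open>Subfields of the complex numbers\<close>

definition rat_adjoin :: "complex set \<Rightarrow> complex set" where
  "rat_adjoin S = generate_field class_ring S"

definition subring_of :: "complex set \<Rightarrow> complex ring" where
  "subring_of K = class_ring\<lparr>carrier := K\<rparr>"

definition Gal :: "complex set \<Rightarrow> complex set \<Rightarrow> (complex \<Rightarrow> complex) monoid" where
  "Gal K F = (BijGroup K)
     \<lparr>carrier := {\<sigma> \<in> Bij K. \<sigma> \<in> Ring.ring_hom (subring_of K) (subring_of K) \<and> (\<forall>x\<in>F. \<sigma> x = x)}\<rparr>"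

abbreviation rat_poly_root :: "rat poly \<Rightarrow> complex \<Rightarrow> bool" where
  "rat_poly_root p z \<equiv> poly (map_poly of_rat p) z = 0"

definition normal_over_rat :: "complex set \<Rightarrow> bool" where
  "normal_over_rat K \<longleftrightarrow>
     (\<forall>p. irreducible p \<and> (\<exists>z\<in>K. rat_poly_root p z) \<longrightarrow>
        (\<exists>zs. set zs \<subseteq> K \<and>
              map_poly of_rat p = Polynomial.smult (of_rat (lead_coeff p)) (\<Prod>z\<leftarrow>zs. [:-z, 1:])))"

definition separable_over_rat :: "complex set \<Rightarrow> bool" where
  "separable_over_rat K \<longleftrightarrow>
     (\<forall>p. irreducible p \<and> (\<exists>z\<in>K. rat_poly_root p z) \<longrightarrow>
        rsquarefree (map_poly of_rat p :: complex poly))"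

definition galois_over_rat :: "complex set \<Rightarrow> bool" where
  "galois_over_rat K \<longleftrightarrow> (\<forall>x\<in>K. algebraic x) \<and> normal_over_rat K \<and> separable_over_rat K"

definition rat_scale :: "rat \<Rightarrow> complex \<Rightarrow> complex" where
  "rat_scale q x = of_rat q * x"

lemma vector_space_rat_scale: "vector_space rat_scale"
  by unfold_locales (simp_all add: rat_scale_def algebra_simps of_rat_add of_rat_mult)

definition rat_degree :: "complex set \<Rightarrow> nat" where
  "rat_degree K = vector_space.dim rat_scale K"

text \<open>The trace of a number field \<open>K\<close> is the sum over all embeddings of \<open>K\<close> into the complex
  numbers. Embeddings are taken extensional, so that each one is counted once; a ring
  homomorphism on a subfield automatically fixes the rationals.\<close>

definition embeddings :: "complex set \<Rightarrow> (complex \<Rightarrow> complex) set" where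
  "embeddings K = Ring.ring_hom (subring_of K) class_ring \<inter> extensional K"

definition field_trace :: "complex set \<Rightarrow> complex \<Rightarrow> complex" where
  "field_trace K x = (\<Sum>\<sigma>\<in>embeddings K. \<sigma> x)"

definition primitive_root_of_unity :: "nat \<Rightarrow> complex \<Rightarrow> bool" where
  "primitive_root_of_unity l z \<longleftrightarrow> l > 0 \<and> z ^ l = 1 \<and> (\<forall>k. 0 < k \<and> k < l \<longrightarrow> z ^ k \<noteq> 1)"


section \<open>Complex representations and characters\<close>

definition representation :: "('g, 'b) monoid_scheme \<Rightarrow> nat \<Rightarrow> ('g \<Rightarrow> complex mat) \<Rightarrow> bool" where
  "representation G n \<rho> \<longleftrightarrow>
     (\<forall>g\<in>carrier G. \<rho> g \<in> carrier_mat n n) \<and>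
     \<rho> \<one>\<^bsub>G\<^esub> = 1\<^sub>m n \<and>
     (\<forall>g\<in>carrier G. \<forall>h\<in>carrier G. \<rho> (g \<otimes>\<^bsub>G\<^esub> h) = \<rho> g * \<rho> h)"

definition irreducible_representation ::
    "('g, 'b) monoid_scheme \<Rightarrow> nat \<Rightarrow> ('g \<Rightarrow> complex mat) \<Rightarrow> bool" where
  "irreducible_representation G n \<rho> \<longleftrightarrow>
     representation G n \<rho> \<and> n > 0 \<and>
     (\<forall>W. VectorSpace.subspace class_ring W (module_vec TYPE(complex) n) \<and>
          (\<forall>g\<in>carrier G. \<forall>v\<in>W. \<rho> g *\<^sub>v v \<in> W) \<longrightarrow>
          W = {0\<^sub>v n} \<or> W = carrier_vec n)"

definition mat_trace :: "complex mat \<Rightarrow> complex" where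
  "mat_trace A = (\<Sum>i<dim_row A. A $$ (i, i))"

text \<open>The values of a character outside the carrier of the group are irrelevant.\<close>

definition irreducible_character :: "('g, 'b) monoid_scheme \<Rightarrow> ('g \<Rightarrow> complex) \<Rightarrow> bool" where
  "irreducible_character G \<chi> \<longleftrightarrow>
     (\<exists>n \<rho>. irreducible_representation G n \<rho> \<and> (\<forall>g\<in>carrier G. \<chi> g = mat_trace (\<rho> g)))"

definition char_order :: "('g, 'b) monoid_scheme \<Rightarrow> ('g \<Rightarrow> complex) \<Rightarrow> nat" where
  "char_order G \<chi> = (LEAST l. l > 0 \<and> (\<forall>g\<in>carrier G. \<chi> g ^ l = 1))"

definition char_field :: "('g, 'b) monoid_scheme \<Rightarrow> ('g \<Rightarrow> complex) \<Rightarrow> complex set" where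
  "char_field G \<chi> = rat_adjoin (\<chi> ` carrier G)"

definition char_Gal :: "('g, 'b) monoid_scheme \<Rightarrow> ('g \<Rightarrow> complex) \<Rightarrow> (complex \<Rightarrow> complex) monoid" where
  "char_Gal G \<chi> = Gal (char_field G \<chi>) \<rat>"


section \<open>The complex group algebra\<close>

text \<open>An element of the group algebra of \<open>G\<close> is its coefficient function, which vanishes outside
  the carrier of \<open>G\<close>. Addition is pointwise; the pointwise product of functions plays no role.\<close>

definition ga_of :: "'g \<Rightarrow> 'g \<Rightarrow> complex" where
  "ga_of g = (\<lambda>x. if x = g then 1 else 0)"

definition ga_scale :: "complex \<Rightarrow> ('g \<Rightarrow> complex) \<Rightarrow> 'g \<Rightarrow> complex" where
  "ga_scale c M = (\<lambda>x. c * M x)"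

definition ga_mult ::
    "('g, 'b) monoid_scheme \<Rightarrow> ('g \<Rightarrow> complex) \<Rightarrow> ('g \<Rightarrow> complex) \<Rightarrow> 'g \<Rightarrow> complex" where
  "ga_mult G M N =
     (\<Sum>g\<in>carrier G. \<Sum>h\<in>carrier G. ga_scale (M g * N h) (ga_of (g \<otimes>\<^bsub>G\<^esub> h)))"

definition rat_group_algebra :: "('g, 'b) monoid_scheme \<Rightarrow> ('g \<Rightarrow> complex) set" where
  "rat_group_algebra G = {M. (\<forall>g\<in>carrier G. M g \<in> \<rat>) \<and> (\<forall>g. g \<notin> carrier G \<longrightarrow> M g = 0)}"

definition ga_rat_scale :: "rat \<Rightarrow> ('g \<Rightarrow> complex) \<Rightarrow> 'g \<Rightarrow> complex" where
  "ga_rat_scale q M = ga_scale (of_rat q) M"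

lemma vector_space_ga_rat_scale: "vector_space ga_rat_scale"
  by unfold_locales
    (simp_all add: ga_rat_scale_def ga_scale_def fun_eq_iff algebra_simps of_rat_add of_rat_mult)

definition central_idempotent :: "('g, 'b) monoid_scheme \<Rightarrow> ('g \<Rightarrow> complex) \<Rightarrow> 'g \<Rightarrow> complex" where
  "central_idempotent G \<chi> =
     ga_scale (\<chi> \<one>\<^bsub>G\<^esub> / of_nat (order G)) (\<Sum>g\<in>carrier G. ga_scale (cnj (\<chi> g)) (ga_of g))"

definition rational_idempotent :: "('g, 'b) monoid_scheme \<Rightarrow> ('g \<Rightarrow> complex) \<Rightarrow> 'g \<Rightarrow> complex" where
  "rational_idempotent G \<chi> =
     (\<Sum>\<sigma>\<in>carrier (char_Gal G \<chi>). central_idempotent G (\<lambda>g. \<sigma> (\<chi> g)))"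

definition LR ::
    "((complex \<Rightarrow> complex), 'b) monoid_scheme \<Rightarrow> complex \<Rightarrow> ((complex \<Rightarrow> complex) \<Rightarrow> complex)
      \<Rightarrow> ((complex \<Rightarrow> complex) \<Rightarrow> complex) set" where
  "LR G \<alpha> \<chi> =
     {M \<in> rat_group_algebra G.
        M = ga_mult G M (rational_idempotent G \<chi>) \<and>
        ga_mult G M (\<Sum>g\<in>carrier G. ga_scale (g \<alpha>) (ga_of (inv\<^bsub>G\<^esub> g))) = 0}"

end

theory Submission
  imports Defs "HOL-Computational_Algebra.Field_as_Ring" "Jordan_Normal_Form.Char_Poly"
begin

text \<open>
  Write \<open>E\<close> for the field generated by \<open>\<zeta>\<close> and \<open>T m = (\<Sum>g. tr (m * cnj (\<chi> g)) g)\<close> for \<open>m\<close> in \<open>E\<close>.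
  If \<open>M\<close> has rational coefficients, then \<open>M * C(\<chi>) = T m\<close> with \<open>m = (\<Sum>g. M g * \<chi> g) / |G|\<close>, and
  by orthogonality of the Galois conjugates of \<open>\<chi>\<close> the same formula recovers \<open>m\<close> from \<open>M = T m\<close>.
  Hence \<open>T\<close> is a rational linear isomorphism of \<open>E\<close> onto the ideal cut out by \<open>M = M * C(\<chi>)\<close>.
  Multiplying \<open>T m\<close> by the element attached to \<open>\<alpha>\<close> yields the function with Fourier coefficients
  \<open>\<sigma> m * (\<Sum>g. cnj (\<sigma> (\<chi> g)) * g \<alpha>)\<close>, where \<open>\<sigma>\<close> runs through the embeddings of \<open>E\<close>; as \<open>\<sigma> m\<close> is
  nonzero for nonzero \<open>m\<close>, either all of the ideal is annihilated or only 0 is. That the \<open>\<sigma>\<close> realise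
  all exponents coprime to \<open>l\<close> is the irreducibility of the cyclotomic polynomial.
\<close>

section \<open>Gauss's lemma and integer minimal polynomials\<close>

section \<open>Irreducibility of cyclotomic polynomials\<close>

text \<open>A form of Gauss's lemma. Contents multiply, so with \<open>f\<close> primitive the
  cofactor carries all of the content of \<open>smult c g\<close>, in particular the factor
  \<open>c\<close>, which can then be cancelled.\<close>

lemma primitive_dvd_smult_int:
  fixes f g :: "int poly"
  assumes "content f = 1" "c \<noteq> 0" "f dvd Polynomial.smult c g"
  shows "f dvd g"
proof -
  obtain q where q: "Polynomial.smult c g = f * q"
    using assms(3) by (auto elim: dvdE)
  hence "content (Polynomial.smult c g) = content q"
    using assms(1) by (simp only: content_mult mult_1_left)
  hence "c dvd content q"
    by (metis content_smult dvd_triv_left normalize_dvd_iff)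
  then obtain q' where "q = [:c:] * q'"
    unfolding const_poly_dvd_iff_dvd_content[symmetric] by (auto elim: dvdE)
  hence "Polynomial.smult c g = Polynomial.smult c (f * q')"
    using q by simp
  hence "g = f * q'"
    using assms(2) smult_cancel by metis
  thus ?thesis
    by simp
qed

lemma rat_poly_clear_denominators:
  fixes g :: "rat poly"
  obtains c :: int and h :: "int poly" where "c > 0" and "of_int_poly h = Polynomial.smult (of_int c) g"
proof -
  have "\<exists>c>0. \<exists>h::int poly. of_int_poly h = Polynomial.smult (of_int c) g"
  proof (induction g)
    case 0
    show ?case
      by (intro exI[of _ 1] conjI exI[of _ 0]) simp_all
  next
    case (pCons a g)
    then obtain c h where ch: "c > 0" "of_int_poly h = Polynomial.smult (rat_of_int c) g"
      by blast
    obtain n d where nd: "quotient_of a = (n, d)"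
      by force
    hence d: "d > 0" and a: "a = of_int n / of_int d"
      by (simp_all add: quotient_of_denom_pos quotient_of_div)
    have "of_int_poly (pCons (c * n) (Polynomial.smult d h))
        = Polynomial.smult (rat_of_int (c * d)) (pCons a g)"
      using d by (simp add: a ch(2) hom_distribs map_poly_pCons mult.commute)
    thus ?case
      using ch(1) d by (intro exI[of _ "c * d"] conjI) (blast | simp)+
  qed
  thus thesis
    using that by blast
qed

text \<open>Take the primitive part of a nonzero integer polynomial of least degree vanishing at
  \<open>z\<close>. Pseudo-division shows that it divides a nonzero constant multiple of every other
  such polynomial, and primitivity removes the constant.\<close>

lemma monic_int_min_poly:
  fixes P :: "int poly" and z :: complex
  assumes "lead_coeff P = 1" and "poly (of_int_poly P) z = 0"
  obtains f :: "int poly" where "lead_coeff f = 1" and "poly (of_int_poly f) z = 0"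
    and "\<And>g. poly (of_int_poly g) z = 0 \<Longrightarrow> f dvd g"
proof -
  define Q where "Q = (\<lambda>g::int poly. g \<noteq> 0 \<and> poly (of_int_poly g) z = 0)"
  have "P \<noteq> 0"
    using assms(1) by force
  hence "Q P"
    using assms(2) by (simp add: Q_def)
  then obtain f0 where f0: "Q f0" and least: "\<And>g. Q g \<Longrightarrow> degree f0 \<le> degree g"
    using ex_has_least_nat[of Q P degree] by blast
  define f1 where "f1 = primitive_part f0"
  have "f1 \<noteq> 0" and deg: "degree f1 = degree f0" and prim: "content f1 = 1"
    using f0 by (simp_all add: f1_def Q_def)
  have "of_int (content f0) * poly (of_int_poly f1) z = 0"
  proof -
    have "f0 = Polynomial.smult (content f0) f1"
      by (simp add: f1_def)
    hence "poly (of_int_poly f0) z = poly (of_int_poly (Polynomial.smult (content f0) f1)) z"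
      by simp
    thus ?thesis
      using f0 unfolding Q_def of_int_hom.map_poly_hom_smult poly_smult by simp
  qed
  hence root: "poly (of_int_poly f1) z = 0"
    using f0 by (simp add: Q_def)
  have dvd: "f1 dvd g" if "poly (of_int_poly g) z = 0" for g
  proof -
    obtain q r where qr: "pseudo_divmod g f1 = (q, r)"
      by force
    define c where "c = lead_coeff f1 ^ (Suc (degree g) - degree f1)"
    have eq: "Polynomial.smult c g = f1 * q + r" and r: "r = 0 \<or> degree r < degree f1"
      using pseudo_divmod[OF \<open>f1 \<noteq> 0\<close> qr] by (simp_all add: c_def)
    have "r = Polynomial.smult c g - f1 * q"
      by (simp add: eq)
    hence "poly (of_int_poly r) z = poly (of_int_poly (Polynomial.smult c g - f1 * q)) z"
      by simp
    also have "\<dots> = 0"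
      using that root by (simp add: hom_distribs)
    finally have "r = 0"
      using least[of r] r deg by (force simp: Q_def)
    hence "f1 dvd Polynomial.smult c g"
      using eq by simp
    moreover have "c \<noteq> 0"
      using \<open>f1 \<noteq> 0\<close> by (simp add: c_def)
    ultimately show ?thesis
      using primitive_dvd_smult_int prim by metis
  qed
  \<comment> \<open>Since \<open>f1\<close> divides the monic \<open>P\<close>, its leading
    coefficient is a unit; scaling \<open>f1\<close> by this sign makes it monic.\<close>
  have "lead_coeff f1 dvd 1"
    using dvd[OF assms(2)] assms(1) by (metis dvd_def lead_coeff_mult)
  hence u: "lead_coeff f1 = 1 \<or> lead_coeff f1 = -1"
    by auto
  show thesis
  proof (rule that[of "Polynomial.smult (lead_coeff f1) f1"])
    show "lead_coeff (Polynomial.smult (lead_coeff f1) f1) = 1"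
      using u by auto
    show "poly (of_int_poly (Polynomial.smult (lead_coeff f1) f1)) z = 0"
      using root by (simp add: hom_distribs)
    show "Polynomial.smult (lead_coeff f1) f1 dvd g" if "poly (of_int_poly g) z = 0" for g
      using dvd[OF that] u by auto
  qed
qed

section \<open>Congruences modulo a prime: the Frobenius map on integer polynomials\<close>

lemma prime_dvd_power_add:
  fixes x y :: "'a::comm_ring_1"
  assumes "prime p"
  shows "of_nat p dvd (x + y) ^ p - (x ^ p + y ^ p)"
proof -
  have "p > 0"
    using assms by (simp add: prime_gt_0_nat)
  hence "(x + y) ^ p = x ^ p + y ^ p + (\<Sum>k\<in>{1..<p}. of_nat (p choose k) * x ^ k * y ^ (p - k))"
  proof -
    have "{..p} = insert 0 (insert p {1..<p})"
      using \<open>p > 0\<close> by auto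
    thus ?thesis
      using \<open>p > 0\<close> by (simp add: binomial_ring algebra_simps)
  qed
  moreover have "of_nat p dvd (\<Sum>k\<in>{1..<p}. of_nat (p choose k) * x ^ k * y ^ (p - k))"
  proof (intro dvd_sum dvd_mult2)
    fix k assume "k \<in> {1..<p}"
    hence "p dvd p choose k"
      using assms by (intro dvd_choose_prime) auto
    thus "(of_nat p :: 'a) dvd of_nat (p choose k)"
      by (metis dvd_def of_nat_mult)
  qed
  ultimately show ?thesis
    by simp
qed

text \<open>Fermat's little theorem. Natural numbers are handled by induction with the binomial
  congruence; an arbitrary integer is replaced by its nonnegative residue modulo
  \<open>p\<close>.\<close>

lemma int_power_prime_dvd_diff:
  fixes a :: int
  assumes "prime p"
  shows "int p dvd a ^ p - a"
proof -
  have nonneg: "int p dvd int n ^ p - int n" for n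
  proof (induction n)
    case 0
    thus ?case
      using assms by (simp add: prime_gt_0_nat power_0_left)
  next
    case (Suc n)
    have "int p dvd (int n + 1) ^ p - (int n ^ p + 1 ^ p)"
      using prime_dvd_power_add[OF assms, of "int n" 1] by simp
    from dvd_add[OF this Suc] show ?case
      by (simp add: algebra_simps)
  qed
  have "int p dvd a ^ p - (a mod int p) ^ p"
    by (metis mod_eq_dvd_iff power_mod)
  moreover have "int p dvd (a mod int p) ^ p - a mod int p"
    using nonneg[of "nat (a mod int p)"] prime_gt_0_nat[OF assms] by simp
  moreover have "int p dvd a mod int p - a"
    by (metis mod_eq_dvd_iff mod_mod_trivial)
  ultimately have "int p dvd (a ^ p - (a mod int p) ^ p) + ((a mod int p) ^ p - a mod int p)
      + (a mod int p - a)"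
    by (intro dvd_add)
  thus ?thesis
    by simp
qed

text \<open>Induction on the coefficients, writing \<open>pCons a f\<close> as
  \<open>[:a:] + X * f\<close>. The difference splits into Fermat's theorem for \<open>a\<close>,
  the induction hypothesis times \<open>X ^ p\<close>, and the mixed binomial terms.\<close>

lemma int_poly_frobenius:
  fixes f :: "int poly"
  assumes "prime p"
  shows "of_nat p dvd f ^ p - f \<circ>\<^sub>p (Polynomial.monom 1 p)"
proof (induction f)
  case 0
  thus ?case
    using assms by (simp add: prime_gt_0_nat power_0_left)
next
  case (pCons a f)
  define X :: "int poly" where "X = Polynomial.monom 1 1"
  have X: "pCons a f = [:a:] + X * f" "Polynomial.monom 1 p = X ^ p"
    by (simp_all add: X_def monom_altdef)
  have "of_nat p dvd [:a:] ^ p - [:a:]"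
  proof -
    obtain b where "a ^ p - a = int p * b"
      using int_power_prime_dvd_diff[OF assms, of a] by (auto elim: dvdE)
    hence "[:a:] ^ p - [:a:] = of_nat p * [:b:]"
      by (simp add: poly_const_pow of_nat_poly)
    thus ?thesis
      by (metis dvd_triv_left)
  qed
  moreover have "of_nat p dvd X ^ p * (f ^ p - f \<circ>\<^sub>p X ^ p)"
    using pCons.IH X(2) by simp
  moreover have "of_nat p dvd ([:a:] + X * f) ^ p - ([:a:] ^ p + (X * f) ^ p)"
    by (rule prime_dvd_power_add[OF assms])
  ultimately have "of_nat p dvd ([:a:] ^ p - [:a:]) + X ^ p * (f ^ p - f \<circ>\<^sub>p X ^ p)
      + (([:a:] + X * f) ^ p - ([:a:] ^ p + (X * f) ^ p))"
    by (intro dvd_add)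
  also have "\<dots> = (pCons a f) ^ p - (pCons a f) \<circ>\<^sub>p (X ^ p)"
    by (simp add: X(1) [symmetric] pcompose_pCons) (simp add: X(1) power_mult_distrib algebra_simps)
  finally show ?case
    by (simp add: X(2))
qed

text \<open>
  Let \<open>f\<close> be the monic minimal polynomial of \<open>z\<close> and \<open>X ^ l - 1 = f * h\<close>. If \<open>f\<close> did not vanish
  at \<open>z ^ p\<close>, then \<open>h\<close> would; differentiating, \<open>f (z ^ p)\<close> divides \<open>l\<close> times a unit in the ring
  generated by \<open>z\<close>. But \<open>f (z ^ p)\<close> is congruent to \<open>(f z) ^ p = 0\<close> modulo \<open>p\<close>, so \<open>p\<close> would divide
  \<open>l\<close> in that ring, and hence in the integers, since \<open>z\<close> satisfies no integer relation of degree
  below \<open>degree f\<close>.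
\<close>

lemma int_root_of_unity_power_prime:
  fixes g :: "int poly" and z :: complex
  assumes "l > 0" "z ^ l = 1" "prime p" "\<not> p dvd l" "poly (of_int_poly g) z = 0"
  shows "poly (of_int_poly g) (z ^ p) = 0"
proof -
  define ev where "ev = (\<lambda>(g::int poly) (w::complex). poly (of_int_poly g) w)"
  have ev_simps: "ev (g + h) w = ev g w + ev h w" "ev (g * h) w = ev g w * ev h w"
    "ev (g - h) w = ev g w - ev h w" "ev (g ^ n) w = ev g w ^ n" "ev (of_nat n) w = of_nat n"
    "ev (- g) w = - ev g w" "ev 1 w = 1" "ev (Polynomial.monom 1 n) w = w ^ n" "ev (g \<circ>\<^sub>p h) w = ev g (ev h w)"
    for g h w n
    by (simp_all add: ev_def hom_distribs poly_monom of_int_poly_hom.hom_power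
        of_int_hom.map_poly_pcompose poly_pcompose)
  define P :: "int poly" where "P = Polynomial.monom 1 l - 1"
  have "poly.coeff P l = 1" "degree P = l"
    using assms(1) by (simp_all add: P_def diff_conv_add_uminus degree_add_eq_left degree_monom_eq
        del: add_uminus_conv_diff)
  hence "lead_coeff P = 1" "ev P z = 0"
    using assms(2) by (simp_all add: P_def ev_simps)
  then obtain f where f: "lead_coeff f = 1" "ev f z = 0" and min: "\<And>g. ev g z = 0 \<Longrightarrow> f dvd g"
    unfolding ev_def using monic_int_min_poly by blast
  have "ev f (z ^ p) = 0"
  proof (rule ccontr)
    assume nz: "ev f (z ^ p) \<noteq> 0"
    obtain h where h: "P = f * h"
      using min[OF \<open>ev P z = 0\<close>] by (auto elim: dvdE)
    have zpl: "(z ^ p) ^ l = 1"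
      using assms(2) by (metis mult.commute power_mult power_one)
    hence "ev P (z ^ p) = 0"
      by (simp add: P_def ev_simps)
    hence hz: "ev h (z ^ p) = 0"
      using nz by (simp add: h ev_simps)
    obtain q where q: "f ^ p - f \<circ>\<^sub>p (Polynomial.monom 1 p) = of_nat p * q"
      using int_poly_frobenius[OF assms(3), of f] by (auto elim: dvdE)
    have "ev (f ^ p - f \<circ>\<^sub>p (Polynomial.monom 1 p)) z = of_nat p * ev q z"
      by (simp add: q ev_simps)
    hence "- ev f (z ^ p) = of_nat p * ev q z"
      using f(2) prime_gt_0_nat[OF assms(3)] by (simp add: ev_simps power_0_left)
    hence fz: "ev f (z ^ p) = - of_nat p * ev q z"
      by (metis minus_minus mult_minus_left)
    have "pderiv P = f * pderiv h + pderiv f * h"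
      by (simp add: h pderiv_mult)
    hence "ev (pderiv P) (z ^ p) = ev f (z ^ p) * ev (pderiv h) (z ^ p)"
      using hz by (simp add: ev_simps)
    moreover have "pderiv P = of_nat l * Polynomial.monom 1 (l - 1)"
      by (simp add: P_def pderiv_monom pderiv_diff of_nat_monom mult_monom)
    ultimately have "of_nat l * (z ^ p) ^ (l - 1) = - of_nat p * ev q z * ev (pderiv h) (z ^ p)"
      by (simp add: ev_simps fz)
    \<comment> \<open>The extra factor \<open>z ^ p\<close> raises the exponent on the left to
      \<open>l\<close>, where the power is 1, so only \<open>l\<close> remains there.\<close>
    hence "of_nat l * (z ^ p) ^ (l - 1) * z ^ p = - of_nat p * ev q z * ev (pderiv h) (z ^ p) * z ^ p"
      by simp
    also have "of_nat l * (z ^ p) ^ (l - 1) * z ^ p = of_nat l"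
      using zpl power_minus_mult[OF assms(1), of "z ^ p"] by (simp only: mult.assoc mult_1_right)
    finally have "of_nat l = of_nat p * ev (- q * (pderiv h \<circ>\<^sub>p Polynomial.monom 1 p) * Polynomial.monom 1 p) z"
      by (simp add: ev_simps)
    then obtain w where w: "of_nat l = of_nat p * ev w z"
      by blast
    obtain u r where qr: "pseudo_divmod w f = (u, r)"
      by force
    have fnz: "f \<noteq> 0"
      using f(1) by force
    \<comment> \<open>As \<open>f\<close> is monic, pseudo-division is genuine division with
      remainder; passing to \<open>r\<close> keeps the value at \<open>z\<close> and lowers the
      degree.\<close>
    have wr: "w = f * u + r" and r: "r = 0 \<or> degree r < degree f"
      using pseudo_divmod[OF fnz qr] f(1) by simp_all
    have "ev (of_nat l - of_nat p * r) z = 0"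
      using w f(2) by (simp add: ev_simps wr)
    hence "f dvd of_nat l - of_nat p * r"
      by (rule min)
    \<comment> \<open>Positive degree puts the constant \<open>l\<close> below
      \<open>degree f\<close>, so that divisibility by \<open>f\<close> forces the difference to
      vanish and coefficients can be compared.\<close>
    moreover have "degree f > 0"
    proof (rule ccontr)
      assume "\<not> degree f > 0"
      hence "f = 1"
        using f(1) by (metis degree_eq_zeroE gr0I lead_coeff_pCons(2) one_pCons)
      thus False
        using f(2) by (simp add: ev_simps)
    qed
    hence "degree (of_nat l - of_nat p * r) < degree f"
      using r degree_mult_le[of "of_nat p" r]
      by (intro degree_diff_less) auto
    ultimately have "of_nat l - of_nat p * r = 0"
      using f(1) by (metis dvd_imp_degree_le leD)
    hence "poly.coeff (of_nat l :: int poly) 0 = poly.coeff (of_nat p * r) 0"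
      by simp
    hence "int l = int p * poly.coeff r 0"
      by (simp add: of_nat_poly)
    thus False
      using assms(4) by (metis dvd_triv_left int_dvd_int_iff)
  qed
  moreover have "f dvd g"
    using assms(5) by (intro min) (simp add: ev_def)
  ultimately have "ev g (z ^ p) = 0"
    by (auto simp: ev_simps elim!: dvdE)
  thus ?thesis
    by (simp add: ev_def)
qed

text \<open>The irreducibility of the cyclotomic polynomial, in the form used later: rational
  relations of \<open>z\<close> pass to \<open>z ^ d\<close>. After clearing denominators, the prime
  factors of \<open>d\<close> are treated one at a time; since each replaces \<open>z\<close> by
  \<open>z ^ p\<close>, the induction runs over all \<open>z\<close> with
  \<open>z ^ l = 1\<close>.\<close>

lemma rat_root_of_unity_power_coprime:
  fixes g :: "rat poly" and z :: complex
  assumes "l > 0" "z ^ l = 1" "coprime d l" "poly (map_poly of_rat g) z = 0"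
  shows "poly (map_poly of_rat g) (z ^ d) = 0"
proof -
  obtain c :: int and h where c: "c > 0" and h: "of_int_poly h = Polynomial.smult (of_int c) g"
    by (rule rat_poly_clear_denominators)
  have ev: "poly (of_int_poly h) w = of_int c * poly (map_poly of_rat g) w" for w :: complex
  proof -
    have "(of_int_poly h :: complex poly) = map_poly of_rat (of_int_poly h)"
      by (simp add: map_poly_map_poly o_def)
    thus ?thesis
      by (simp add: h hom_distribs)
  qed
  have "poly (of_int_poly h) (z ^ d) = 0"
    if "z ^ l = 1" "poly (of_int_poly h) z = 0" for z :: complex
    using assms(3) that
  proof (induction d arbitrary: z rule: prime_divisors_induct)
    \<comment> \<open>Coprimality of 0 and \<open>l\<close> forces \<open>l = 1\<close>, hence
      \<open>z = 1\<close>.\<close>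
    case zero
    thus ?case by simp
  next
    case (unit x)
    thus ?case by simp
  next
    case (factor p x)
    hence "\<not> p dvd l"
      using coprime_common_divisor[of "p * x" l p] by auto
    hence "poly (of_int_poly h) (z ^ p) = 0"
      using factor assms(1) by (intro int_root_of_unity_power_prime[of l]) auto
    moreover have "(z ^ p) ^ l = 1"
      using factor.prems by (metis mult.commute power_mult power_one)
    ultimately show ?case
      using factor.IH[of "z ^ p"] factor.prems by (simp add: power_mult)
  qed
  thus ?thesis
    using assms c by (simp add: ev)
qed

section \<open>Generated subfields and their embeddings\<close>

lemma rat_adjoin_one: "1 \<in> rat_adjoin S"
  using generate_field.one[of class_ring S] by (simp add: rat_adjoin_def)

lemma rat_adjoin_incl: "x \<in> S \<Longrightarrow> x \<in> rat_adjoin S"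
  by (simp add: rat_adjoin_def generate_field.incl)

lemma rat_adjoin_add: "x \<in> rat_adjoin S \<Longrightarrow> y \<in> rat_adjoin S \<Longrightarrow> x + y \<in> rat_adjoin S"
  using generate_field.eng_add[of x class_ring S y] by (simp add: rat_adjoin_def)

lemma rat_adjoin_mult: "x \<in> rat_adjoin S \<Longrightarrow> y \<in> rat_adjoin S \<Longrightarrow> x * y \<in> rat_adjoin S"
  using generate_field.eng_mult[of x class_ring S y] by (simp add: rat_adjoin_def)

lemma rat_adjoin_uminus: "x \<in> rat_adjoin S \<Longrightarrow> - x \<in> rat_adjoin S"
  using generate_field.a_inv[of x class_ring S] by (simp add: rat_adjoin_def class_ring_simps)

lemma rat_adjoin_zero: "0 \<in> rat_adjoin S"
  using rat_adjoin_add[OF rat_adjoin_one rat_adjoin_uminus[OF rat_adjoin_one], of S] by simp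

lemma rat_adjoin_inverse: "x \<in> rat_adjoin S \<Longrightarrow> inverse x \<in> rat_adjoin S"
  using generate_field.m_inv[of x class_ring S]
  by (cases "x = 0") (simp_all add: rat_adjoin_def rat_adjoin_zero[unfolded rat_adjoin_def] class_ring_simps)

lemma rat_adjoin_power: "x \<in> rat_adjoin S \<Longrightarrow> x ^ n \<in> rat_adjoin S"
  by (induction n) (auto intro: rat_adjoin_one rat_adjoin_mult)

lemma rat_adjoin_sum: "(\<And>i. i \<in> A \<Longrightarrow> f i \<in> rat_adjoin S) \<Longrightarrow> sum f A \<in> rat_adjoin S"
  by (induction A rule: infinite_finite_induct) (auto intro: rat_adjoin_zero rat_adjoin_add)

lemma rat_adjoin_of_nat: "of_nat n \<in> rat_adjoin S"
  by (induction n) (auto intro: rat_adjoin_zero rat_adjoin_one rat_adjoin_add)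

lemma rat_adjoin_of_rat: "of_rat r \<in> rat_adjoin S"
proof -
  have int: "of_int n \<in> rat_adjoin S" for n
    by (cases n rule: int_cases2) (auto intro: rat_adjoin_uminus rat_adjoin_of_nat)
  obtain a b where "r = of_int a * inverse (of_int b)"
    by (cases r) (auto simp: Fract_of_int_quotient divide_inverse)
  thus ?thesis
    using int by (auto simp: of_rat_mult of_rat_inverse intro!: rat_adjoin_mult rat_adjoin_inverse)
qed

lemma rat_adjoin_poly:
  "z \<in> rat_adjoin S \<Longrightarrow> poly (map_poly of_rat q) z \<in> rat_adjoin S"
  by (induction q)
    (auto simp: map_poly_pCons intro: rat_adjoin_zero rat_adjoin_add rat_adjoin_mult rat_adjoin_of_rat)

lemma rat_adjoin_induct [consumes 1, case_names one incl uminus inverse add mult]: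
  assumes "x \<in> rat_adjoin S" "P 1" "\<And>x. x \<in> S \<Longrightarrow> P x"
    "\<And>x. x \<in> rat_adjoin S \<Longrightarrow> P x \<Longrightarrow> P (- x)"
    "\<And>x. x \<in> rat_adjoin S \<Longrightarrow> x \<noteq> 0 \<Longrightarrow> P x \<Longrightarrow> P (inverse x)"
    "\<And>x y. x \<in> rat_adjoin S \<Longrightarrow> P x \<Longrightarrow> y \<in> rat_adjoin S \<Longrightarrow> P y \<Longrightarrow> P (x + y)"
    "\<And>x y. x \<in> rat_adjoin S \<Longrightarrow> P x \<Longrightarrow> y \<in> rat_adjoin S \<Longrightarrow> P y \<Longrightarrow> P (x * y)"
  shows "P x"
  using assms(1) unfolding rat_adjoin_def
proof (induction rule: generate_field.induct)
  case (m_inv h)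
  thus ?case
    using assms(5)[of h] by (simp add: rat_adjoin_def class_ring_simps)
qed (use assms in \<open>simp_all add: rat_adjoin_def class_ring_simps\<close>)

lemma rat_adjoin_minimal:
  assumes "S \<subseteq> rat_adjoin T"
  shows "rat_adjoin S \<subseteq> rat_adjoin T"
proof
  fix x assume "x \<in> rat_adjoin S"
  thus "x \<in> rat_adjoin T"
    by (induction rule: rat_adjoin_induct)
      (use assms in \<open>auto intro: rat_adjoin_one rat_adjoin_uminus rat_adjoin_inverse rat_adjoin_add rat_adjoin_mult\<close>)
qed

section \<open>Simple algebraic extensions as rings of polynomial values\<close>

lemma poly_of_rat_mult:
  "poly (map_poly of_rat (p * q)) z = poly (map_poly of_rat p) z * poly (map_poly of_rat q) (z :: complex)"
  by (induction p) (simp_all add: hom_distribs map_poly_pCons algebra_simps)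

lemma poly_of_rat_add:
  "poly (map_poly of_rat (p + q)) z = poly (map_poly of_rat p) z + poly (map_poly of_rat q) (z :: complex)"
  by (simp add: hom_distribs)

lemma poly_of_rat_uminus:
  "poly (map_poly of_rat (- p)) z = - poly (map_poly of_rat p) (z :: complex)"
  using poly_of_rat_add[of p "- p" z] by (simp add: eq_neg_iff_add_eq_0 add.commute)

text \<open>Let \<open>F\<close> be a rational polynomial of least degree vanishing at
  \<open>z\<close>. The gcd of \<open>q\<close> and \<open>F\<close> does not vanish at
  \<open>z\<close>, so the cofactor of \<open>F\<close> does; minimality makes the gcd constant, and
  a Bezout identity evaluated at \<open>z\<close> exhibits the inverse.\<close>

lemma rat_poly_inverse:
  fixes z :: complex
  assumes "p \<noteq> 0" "poly (map_poly of_rat p) z = 0" "poly (map_poly of_rat q) z \<noteq> 0"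
  shows "\<exists>r. inverse (poly (map_poly of_rat q) z) = poly (map_poly of_rat r) z"
proof -
  define ev where "ev = (\<lambda>q. poly (map_poly of_rat q) z)"
  have ev_simps: "ev (g + h) = ev g + ev h" "ev (g * h) = ev g * ev h" "ev 1 = 1" for g h
    by (simp_all add: ev_def poly_of_rat_mult poly_of_rat_add)
  obtain F where F: "F \<noteq> 0" "ev F = 0" and least: "\<And>g. g \<noteq> 0 \<Longrightarrow> ev g = 0 \<Longrightarrow> degree F \<le> degree g"
    using ex_has_least_nat[of "\<lambda>g. g \<noteq> 0 \<and> ev g = 0" p degree] assms(1,2) unfolding ev_def by blast
  define g where "g = gcd q F"
  obtain F' where F': "F = g * F'"
    unfolding g_def by (meson dvdE gcd_dvd2)
  have "ev g \<noteq> 0"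
  proof
    assume "ev g = 0"
    moreover obtain q' where "q = g * q'"
      unfolding g_def by (meson dvdE gcd_dvd1)
    ultimately have "ev q = 0"
      by (simp add: ev_simps)
    thus False
      using assms(3) by (simp add: ev_def)
  qed
  hence "ev F' = 0"
    using F(2) by (simp add: F' ev_simps)
  moreover have "F' \<noteq> 0" "g \<noteq> 0"
    using F(1) F' by auto
  ultimately have "degree g = 0"
    using least[of F'] by (simp add: F' degree_mult_eq)
  hence "is_unit g"
    using \<open>g \<noteq> 0\<close> is_unit_iff_degree by blast
  hence "g = 1"
    unfolding g_def is_unit_gcd by (rule coprime_imp_gcd_eq_1)
  obtain a b where "a * q + b * F = g"
    unfolding g_def using bezout_coefficients_fst_snd by blast
  hence "ev (a * q + b * F) = 1"
    by (simp add: \<open>g = 1\<close> ev_simps)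
  hence "inverse (ev q) = ev a"
    using F(2) by (simp add: ev_simps inverse_unique mult.commute)
  thus ?thesis
    unfolding ev_def by blast
qed

text \<open>For algebraic \<open>z\<close> the polynomial values are closed under inversion by
  \<open>rat_poly_inverse\<close>, hence already form a field.\<close>

lemma rat_adjoin_singleton:
  fixes z :: complex
  assumes "p \<noteq> 0" "poly (map_poly of_rat p) z = 0"
  shows "rat_adjoin {z} = range (\<lambda>q. poly (map_poly of_rat q) z)"
proof
  show "range (\<lambda>q. poly (map_poly of_rat q) z) \<subseteq> rat_adjoin {z}"
    using rat_adjoin_poly[OF rat_adjoin_incl[of z "{z}"]] by auto
  show "rat_adjoin {z} \<subseteq> range (\<lambda>q. poly (map_poly of_rat q) z)"
  proof
    fix x assume "x \<in> rat_adjoin {z}"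
    thus "x \<in> range (\<lambda>q. poly (map_poly of_rat q) z)"
    proof (induction rule: rat_adjoin_induct)
      case one
      show ?case
        by (rule range_eqI[of _ _ 1]) simp
    next
      case (incl x)
      thus ?case
        by (intro range_eqI[of _ _ "[:0, 1:]"]) (simp add: map_poly_pCons)
    next
      case (uminus x)
      then obtain q where "x = poly (map_poly of_rat q) z"
        by blast
      thus ?case
        by (intro range_eqI[of _ _ "- q"]) (simp add: poly_of_rat_uminus)
    next
      case (inverse x)
      then obtain q where q: "x = poly (map_poly of_rat q) z"
        by blast
      then obtain r where "inverse x = poly (map_poly of_rat r) z"
        using rat_poly_inverse[OF assms] \<open>x \<noteq> 0\<close> by blast
      thus ?case
        by (rule range_eqI)
    next
      case (add x y)
      then obtain q r where "x = poly (map_poly of_rat q) z" "y = poly (map_poly of_rat r) z"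
        by blast
      thus ?case
        by (intro range_eqI[of _ _ "q + r"]) (simp add: hom_distribs)
    next
      case (mult x y)
      then obtain q r where "x = poly (map_poly of_rat q) z" "y = poly (map_poly of_rat r) z"
        by blast
      thus ?case
        by (intro range_eqI[of _ _ "q * r"]) (simp add: poly_of_rat_mult)
    qed
  qed
qed

section \<open>Ring homomorphisms from a generated field into the complex numbers\<close>

lemma subring_of_hom_iff:
  "\<sigma> \<in> Ring.ring_hom (subring_of K) class_ring \<longleftrightarrow>
    (\<forall>x\<in>K. \<forall>y\<in>K. \<sigma> (x * y) = \<sigma> x * \<sigma> y \<and> \<sigma> (x + y) = \<sigma> x + \<sigma> y) \<and> \<sigma> 1 = 1"
  by (auto simp: Ring.ring_hom_def subring_of_def)

lemma subring_of_endo_iff: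
  "\<sigma> \<in> Ring.ring_hom (subring_of K) (subring_of K) \<longleftrightarrow>
    \<sigma> ` K \<subseteq> K \<and> \<sigma> \<in> Ring.ring_hom (subring_of K) class_ring"
  by (auto simp: Ring.ring_hom_def subring_of_def)

context
  fixes S and \<sigma> :: "complex \<Rightarrow> complex"
  assumes hom: "\<sigma> \<in> Ring.ring_hom (subring_of (rat_adjoin S)) class_ring"
begin

lemma emb_one: "\<sigma> 1 = 1"
  using hom by (simp add: subring_of_hom_iff)

lemma emb_add: "x \<in> rat_adjoin S \<Longrightarrow> y \<in> rat_adjoin S \<Longrightarrow> \<sigma> (x + y) = \<sigma> x + \<sigma> y"
  using hom by (simp add: subring_of_hom_iff)

lemma emb_mult: "x \<in> rat_adjoin S \<Longrightarrow> y \<in> rat_adjoin S \<Longrightarrow> \<sigma> (x * y) = \<sigma> x * \<sigma> y"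
  using hom by (simp add: subring_of_hom_iff)

lemma emb_zero: "\<sigma> 0 = 0"
  using emb_add[of 0 0] by (simp add: rat_adjoin_zero)

lemma emb_uminus: "x \<in> rat_adjoin S \<Longrightarrow> \<sigma> (- x) = - \<sigma> x"
  using emb_add[OF rat_adjoin_uminus, of x x] by (simp add: emb_zero eq_neg_iff_add_eq_0)

lemma emb_inverse: "x \<in> rat_adjoin S \<Longrightarrow> \<sigma> (inverse x) = inverse (\<sigma> x)"
proof (cases "x = 0")
  case False
  assume x: "x \<in> rat_adjoin S"
  hence "\<sigma> x * \<sigma> (inverse x) = 1"
    using emb_mult[of x "inverse x"] False by (simp add: rat_adjoin_inverse emb_one)
  thus ?thesis
    by (simp add: inverse_unique)
qed (simp add: emb_zero)

lemma emb_eq_0_iff: "x \<in> rat_adjoin S \<Longrightarrow> \<sigma> x = 0 \<longleftrightarrow> x = 0"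
  using emb_mult[of x "inverse x"] emb_zero emb_one
  by (cases "x = 0") (auto simp: rat_adjoin_inverse)

lemma emb_inj: "inj_on \<sigma> (rat_adjoin S)"
proof (rule inj_onI)
  fix x y assume xy: "x \<in> rat_adjoin S" "y \<in> rat_adjoin S" "\<sigma> x = \<sigma> y"
  have "\<sigma> (x + - y) = 0"
    using xy emb_add[of x "- y"] emb_uminus[of y] by (simp add: rat_adjoin_uminus)
  thus "x = y"
    using xy emb_eq_0_iff[OF rat_adjoin_add[OF xy(1) rat_adjoin_uminus[OF xy(2)]]] by simp
qed

lemma emb_power: "x \<in> rat_adjoin S \<Longrightarrow> \<sigma> (x ^ n) = \<sigma> x ^ n"
  by (induction n) (simp_all add: emb_one emb_mult rat_adjoin_power)

lemma emb_sum: "(\<And>i. i \<in> A \<Longrightarrow> f i \<in> rat_adjoin S) \<Longrightarrow> \<sigma> (sum f A) = (\<Sum>i\<in>A. \<sigma> (f i))"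
  by (induction A rule: infinite_finite_induct) (simp_all add: emb_zero emb_add rat_adjoin_sum)

lemma emb_of_nat: "\<sigma> (of_nat n) = of_nat n"
  by (induction n) (simp_all add: emb_zero emb_one emb_add rat_adjoin_of_nat rat_adjoin_one)

lemma emb_of_int: "\<sigma> (of_int n) = of_int n"
  by (cases n rule: int_cases2) (simp_all add: emb_of_nat emb_uminus rat_adjoin_of_nat)

lemma emb_of_rat: "\<sigma> (of_rat r) = of_rat r"
proof -
  obtain a b where r: "r = of_int a * inverse (of_int b)"
    by (cases r) (auto simp: Fract_of_int_quotient divide_inverse)
  have mem: "of_int n \<in> rat_adjoin S" for n
    using rat_adjoin_of_rat[of "of_int n" S] by simp
  show ?thesis
    by (simp add: r of_rat_mult of_rat_inverse emb_mult[OF mem rat_adjoin_inverse[OF mem]]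
        emb_inverse[OF mem] emb_of_int)
qed

lemma emb_poly: "z \<in> rat_adjoin S \<Longrightarrow> \<sigma> (poly (map_poly of_rat q) z) = poly (map_poly of_rat q) (\<sigma> z)"
  by (induction q)
    (simp_all add: map_poly_pCons emb_zero emb_add emb_mult emb_of_rat rat_adjoin_of_rat
      rat_adjoin_mult rat_adjoin_poly)

lemma emb_rat: "x \<in> \<rat> \<Longrightarrow> \<sigma> x = x"
  by (auto elim!: Rats_cases simp: emb_of_rat)

end

lemma emb_eqI:
  fixes \<sigma> \<tau> :: "complex \<Rightarrow> complex"
  assumes "\<sigma> \<in> Ring.ring_hom (subring_of (rat_adjoin S)) class_ring"
    "\<tau> \<in> Ring.ring_hom (subring_of (rat_adjoin S)) class_ring" "\<And>x. x \<in> S \<Longrightarrow> \<sigma> x = \<tau> x"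
    and "x \<in> rat_adjoin S"
  shows "\<sigma> x = \<tau> x"
  using assms(4)
proof (induction rule: rat_adjoin_induct)
  case one
  show ?case
    using assms(1,2)[THEN emb_one] by simp
qed (simp_all add: assms(3) assms(1,2)[THEN emb_uminus] assms(1,2)[THEN emb_inverse]
    assms(1,2)[THEN emb_add] assms(1,2)[THEN emb_mult])

lemma embeddings_hom: "\<sigma> \<in> embeddings K \<Longrightarrow> \<sigma> \<in> Ring.ring_hom (subring_of K) class_ring"
  by (simp add: embeddings_def)

lemma embeddings_eqI:
  fixes \<sigma> \<tau> :: "complex \<Rightarrow> complex"
  assumes "\<sigma> \<in> embeddings (rat_adjoin S)" "\<tau> \<in> embeddings (rat_adjoin S)" "\<And>x. x \<in> S \<Longrightarrow> \<sigma> x = \<tau> x"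
  shows "\<sigma> = \<tau>"
proof (rule extensionalityI[of _ "rat_adjoin S"])
  fix x assume "x \<in> rat_adjoin S"
  thus "\<sigma> x = \<tau> x"
    using emb_eqI[OF embeddings_hom[OF assms(1)] embeddings_hom[OF assms(2)]] assms(3) by blast
qed (use assms in \<open>auto simp: embeddings_def\<close>)

text \<open>Elements of \<open>Bij K\<close> are extensional, as embeddings are. Galois groups and
  the index sets of traces can therefore be compared as sets of functions.\<close>

lemma carrier_Gal: "carrier (Gal K F) = {\<sigma> \<in> embeddings K. bij_betw \<sigma> K K \<and> (\<forall>x\<in>F. \<sigma> x = x)}"
  by (auto simp: Gal_def embeddings_def Bij_def subring_of_endo_iff bij_betw_def)

section \<open>Cyclotomic fields\<close>

lemma primitive_rootD:
  assumes "primitive_root_of_unity l z"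
  shows "l > 0" "z ^ l = 1" "z \<noteq> 0"
  using assms by (auto simp: primitive_root_of_unity_def power_0_left)

lemma primitive_root_power_eq_1_iff:
  assumes "primitive_root_of_unity l z"
  shows "z ^ n = 1 \<longleftrightarrow> l dvd n"
proof
  note z = primitive_rootD[OF assms]
  have "z ^ n = z ^ (l * (n div l) + n mod l)"
    by simp
  also have "\<dots> = z ^ (n mod l)"
    by (simp only: power_add power_mult z power_one mult_1_left)
  finally have "z ^ (n mod l) = z ^ n" ..
  moreover assume "z ^ n = 1"
  ultimately have "\<not> 0 < n mod l"
    using assms z(1) by (auto simp: primitive_root_of_unity_def)
  thus "l dvd n"
    by (simp add: dvd_eq_mod_eq_0)
next
  assume "l dvd n"
  thus "z ^ n = 1"
    using primitive_rootD(2)[OF assms] by (auto simp: power_mult elim!: dvdE)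
qed

lemma primitive_rootI:
  assumes "l > 0" "\<And>n. z ^ n = 1 \<longleftrightarrow> l dvd n"
  shows "primitive_root_of_unity l z"
  using assms by (auto simp: primitive_root_of_unity_def dest: nat_dvd_not_less)

text \<open>By counting: the first \<open>l\<close> powers of \<open>z\<close> are distinct roots of
  unity, and there are exactly \<open>l\<close> of these.\<close>

lemma roots_of_unity_eq_powers:
  assumes "primitive_root_of_unity l z"
  shows "{w. w ^ l = 1} = (\<lambda>k. z ^ k) ` {..<l}"
proof -
  note z = primitive_rootD[OF assms]
  have inj: "inj_on (\<lambda>k. z ^ k) {..<l}"
  proof (rule linorder_inj_onI)
    fix i j assume ij: "i < j" "i \<in> {..<l}" "j \<in> {..<l}"
    have "z ^ j = z ^ i * z ^ (j - i)"
      using ij by (simp flip: power_add)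
    moreover have "z ^ (j - i) \<noteq> 1"
      using assms ij by (auto simp: primitive_root_of_unity_def)
    ultimately show "z ^ i \<noteq> z ^ j"
      using z(3) by auto
  qed auto
  have "(\<lambda>k. z ^ k) ` {..<l} = {w. w ^ l = 1}"
  proof (rule card_subset_eq)
    show "finite {w::complex. w ^ l = 1}"
      using z(1) by (intro finite_roots_unity) simp
    have "(z ^ k) ^ l = 1" for k
      using z(2) by (metis mult.commute power_mult power_one)
    thus "(\<lambda>k. z ^ k) ` {..<l} \<subseteq> {w. w ^ l = 1}"
      by auto
    show "card ((\<lambda>k. z ^ k) ` {..<l}) = card {w::complex. w ^ l = 1}"
      using inj z(1) by (simp add: card_image card_roots_unity_eq)
  qed
  thus ?thesis ..
qed

text \<open>Divide \<open>l\<close> by \<open>gcd d l\<close> to get \<open>l'\<close>. Then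
  \<open>l\<close> divides \<open>d * l'\<close>, so \<open>z ^ d\<close> has \<open>l'\<close>-th
  power 1, and primitivity leaves only gcd 1. Conversely, a factor \<open>d\<close> coprime to
  \<open>l\<close> cancels from \<open>l dvd d * n\<close>.\<close>

lemma primitive_root_power_iff:
  assumes "primitive_root_of_unity l z"
  shows "primitive_root_of_unity l (z ^ d) \<longleftrightarrow> coprime d l"
proof
  note z = primitive_rootD[OF assms]
  assume pr: "primitive_root_of_unity l (z ^ d)"
  obtain l' where l': "l = gcd d l * l'"
    by (meson dvdE gcd_dvd2)
  obtain d' where d': "d = gcd d l * d'"
    by (meson dvdE gcd_dvd1)
  have "d * l' = l * d'"
    by (subst d', subst (2) l') (simp add: ac_simps)
  hence "(z ^ d) ^ l' = 1"
    unfolding power_mult[symmetric] primitive_root_power_eq_1_iff[OF assms] by simp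
  hence "l dvd l'"
    by (simp add: primitive_root_power_eq_1_iff[OF pr])
  moreover have "l' > 0"
    using z(1) l' by (cases l') auto
  ultimately have "gcd d l * l' \<le> 1 * l'"
    using l' dvd_imp_le by fastforce
  hence "gcd d l \<le> 1"
    using \<open>l' > 0\<close> by simp
  hence "gcd d l = 1"
    using z(1) by (metis gcd_pos_nat le_antisym less_numeral_extra(3) One_nat_def Suc_leI)
  thus "coprime d l"
    by (rule gcd_eq_1_imp_coprime)
next
  assume "coprime d l"
  show "primitive_root_of_unity l (z ^ d)"
  proof (rule primitive_rootI)
    fix n
    have "(z ^ d) ^ n = 1 \<longleftrightarrow> l dvd d * n"
      unfolding power_mult[symmetric] primitive_root_power_eq_1_iff[OF assms] ..
    also have "\<dots> \<longleftrightarrow> l dvd n"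
      using \<open>coprime d l\<close> by (simp add: coprime_dvd_mult_right_iff coprime_commute)
    finally show "(z ^ d) ^ n = 1 \<longleftrightarrow> l dvd n" .
  qed (rule primitive_rootD(1)[OF assms])
qed

lemma primitive_rootE:
  assumes "primitive_root_of_unity l z" "primitive_root_of_unity l w"
  obtains d where "w = z ^ d" "coprime d l"
proof -
  have "w \<in> {w. w ^ l = 1}"
    using primitive_rootD(2)[OF assms(2)] by simp
  then obtain d where "w = z ^ d"
    unfolding roots_of_unity_eq_powers[OF assms(1)] by blast
  thus thesis
    using that assms primitive_root_power_iff by blast
qed

text \<open>The witness is the multiplicative order of \<open>z\<close>.\<close>

lemma ex_primitive_root_dvd:
  fixes z :: complex
  assumes "l > 0" "z ^ l = 1"
  obtains e where "e dvd l" "primitive_root_of_unity e z"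
proof -
  define e where "e = (LEAST e. 0 < e \<and> z ^ e = 1)"
  have "0 < e \<and> z ^ e = 1"
    unfolding e_def using assms by (intro LeastI) auto
  moreover have "z ^ k \<noteq> 1" if "0 < k" "k < e" for k
    using not_less_Least[of k "\<lambda>e. 0 < e \<and> z ^ e = 1"] that by (simp add: e_def)
  ultimately have "primitive_root_of_unity e z"
    by (simp add: primitive_root_of_unity_def)
  thus thesis
    using that assms(2) primitive_root_power_eq_1_iff by blast
qed

section \<open>Rationality of power sums of roots of unity\<close>

lemma sum_roots_of_unity_power_Rats:
  assumes "l > 0"
  shows "(\<Sum>z | z ^ l = 1. z ^ k) \<in> (\<rat> :: complex set)"
proof (cases "\<forall>z::complex. z ^ l = 1 \<longrightarrow> z ^ k = 1")
  case True
  thus ?thesis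
    by simp
next
  case False
  then obtain w :: complex where w: "w ^ l = 1" "w ^ k \<noteq> 1"
    by blast
  hence "w \<noteq> 0"
    using assms by (auto simp: power_0_left)
  \<comment> \<open>Multiplication by \<open>w\<close> permutes the roots of unity and scales the
    sum by \<open>w ^ k\<close>, which differs from 1; so the sum is 0.\<close>
  have "(\<Sum>z | z ^ l = 1. z ^ k) = (\<Sum>z | z ^ l = 1. (w * z) ^ k)"
    using w \<open>w \<noteq> 0\<close>
    by (intro sum.reindex_bij_witness[of _ "\<lambda>z. w * z" "\<lambda>z. inverse w * z"])
      (auto simp: power_mult_distrib power_inverse)
  also have "\<dots> = w ^ k * (\<Sum>z | z ^ l = 1. z ^ k)"
    by (simp add: power_mult_distrib sum_distrib_left)
  finally have "(\<Sum>z::complex | z ^ l = 1. z ^ k) = 0"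
    using w(2) by simp
  thus ?thesis
    by simp
qed

text \<open>Ramanujan sums: the roots of unity of order dividing \<open>l\<close> are partitioned by their exact order.\<close>

lemma sum_primitive_roots_power_Rats:
  "l > 0 \<Longrightarrow> (\<Sum>z | primitive_root_of_unity l z. z ^ k) \<in> \<rat>"
proof (induction l rule: less_induct)
  case (less l)
  define R where "R = (\<lambda>e. {z. primitive_root_of_unity e z})"
  have fin: "finite (R e)" for e
  proof (cases "e > 0")
    case True
    have "R e \<subseteq> {z. z ^ e = 1}"
      by (auto simp: R_def primitive_root_of_unity_def)
    moreover have "finite {z::complex. z ^ e = 1}"
      using True by (intro finite_roots_unity) simp
    ultimately show ?thesis
      by (rule finite_subset)
  qed (simp add: R_def primitive_root_of_unity_def)
  have disj: "R e \<inter> R e' = {}" if "e \<noteq> e'" for e e'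
  proof -
    have "e dvd e' \<and> e' dvd e" if "z \<in> R e" "z \<in> R e'" for z
      using that primitive_root_power_eq_1_iff primitive_rootD(2) unfolding R_def by blast
    thus ?thesis
      using that dvd_antisym by blast
  qed
  have "{z. z ^ l = 1} = (\<Union>e\<in>{e. e dvd l}. R e)"
  proof (intro equalityI subsetI)
    fix z :: complex assume "z \<in> {z. z ^ l = 1}"
    then obtain e where "e dvd l" "primitive_root_of_unity e z"
      using ex_primitive_root_dvd[OF less.prems, of z] by blast
    thus "z \<in> (\<Union>e\<in>{e. e dvd l}. R e)"
      by (auto simp: R_def)
  qed (auto simp: R_def primitive_root_power_eq_1_iff)
  hence "(\<Sum>z | z ^ l = 1. z ^ k) = (\<Sum>e | e dvd l. \<Sum>z\<in>R e. z ^ k)"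
    using less.prems fin disj by (simp add: sum.UNION_disjoint)
  also have "\<dots> = (\<Sum>z\<in>R l. z ^ k) + (\<Sum>e\<in>{e. e dvd l} - {l}. \<Sum>z\<in>R e. z ^ k)"
    using less.prems by (subst sum.remove[of _ l]) simp_all
  finally have "(\<Sum>z\<in>R l. z ^ k)
      = (\<Sum>z | z ^ l = 1. z ^ k) - (\<Sum>e\<in>{e. e dvd l} - {l}. \<Sum>z\<in>R e. z ^ k)"
    by simp
  also have "\<dots> \<in> \<rat>"
  proof (rule Rats_diff[OF sum_roots_of_unity_power_Rats[OF less.prems] Rats_sum])
    fix e assume "e \<in> {e. e dvd l} - {l}"
    hence "e < l" "e > 0"
      using less.prems by (auto dest: dvd_imp_le intro: Nat.gr0I)
    thus "(\<Sum>z\<in>R e. z ^ k) \<in> \<rat>"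
      using less.IH by (simp add: R_def)
  qed
  finally show ?case
    by (simp add: R_def)
qed

section \<open>Embeddings, automorphisms and traces of a cyclotomic field\<close>

context
  fixes l :: nat and \<zeta> :: complex
  assumes prim: "primitive_root_of_unity l \<zeta>"
begin

lemma cyclotomic_field_eq:
  "rat_adjoin {\<zeta>} = range (\<lambda>q. poly (map_poly of_rat q) \<zeta>)"
proof (rule rat_adjoin_singleton)
  let ?p = "Polynomial.monom 1 l + [:-1:] :: rat poly"
  have "degree ?p = l"
    using primitive_rootD(1)[OF prim] by (subst degree_add_eq_left) (simp_all add: degree_monom_eq)
  thus "?p \<noteq> 0"
    using primitive_rootD(1)[OF prim] by (metis degree_0 less_irrefl)
  show "poly (map_poly of_rat ?p) \<zeta> = 0"
    using primitive_rootD(2)[OF prim]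
    by (simp add: poly_of_rat_add map_poly_pCons map_poly_monom poly_monom)
qed

lemma cyclotomic_gen: "\<zeta> \<in> rat_adjoin {\<zeta>}"
  by (simp add: rat_adjoin_incl)

text \<open>The embedding sends the value of a polynomial at \<zeta> to its value at
  \<open>z\<close>. This is well defined because \<open>z\<close> is a power of \<zeta> with
  exponent coprime to \<open>l\<close>, so every rational relation of \<zeta> also holds for
  \<open>z\<close>.\<close>

lemma cyclotomic_embedding_exists:
  assumes "primitive_root_of_unity l z"
  obtains \<sigma> where "\<sigma> \<in> embeddings (rat_adjoin {\<zeta>})" "\<sigma> \<zeta> = z"
proof -
  define ev where "ev = (\<lambda>q (z::complex). poly (map_poly of_rat q) z)"
  obtain d where d: "z = \<zeta> ^ d" "coprime d l"
    using primitive_rootE[OF prim assms] by blast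
  have ev_eq: "ev q z = ev r z" if "ev q \<zeta> = ev r \<zeta>" for q r
  proof -
    have "ev (q + - r) \<zeta> = 0"
      using that unfolding ev_def poly_of_rat_add poly_of_rat_uminus by simp
    hence "ev (q + - r) z = 0"
      unfolding d(1) ev_def using primitive_rootD[OF prim] d(2)
      by (intro rat_root_of_unity_power_coprime[of l]) auto
    thus ?thesis
      unfolding ev_def poly_of_rat_add poly_of_rat_uminus by simp
  qed
  \<comment> \<open>\<open>SOME\<close> picks any polynomial representing \<open>x\<close>, a choice
    made harmless by \<open>ev_eq\<close>; the restricted abstraction makes the map
    extensional.\<close>
  define \<sigma> where "\<sigma> = (\<lambda>x\<in>rat_adjoin {\<zeta>}. ev (SOME q. ev q \<zeta> = x) z)"
  have \<sigma>: "\<sigma> (ev q \<zeta>) = ev q z" for q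
  proof -
    have "ev (SOME r. ev r \<zeta> = ev q \<zeta>) \<zeta> = ev q \<zeta>"
      by (rule someI) simp
    hence "ev (SOME r. ev r \<zeta> = ev q \<zeta>) z = ev q z"
      by (rule ev_eq)
    moreover have "ev q \<zeta> \<in> rat_adjoin {\<zeta>}"
      by (simp add: cyclotomic_field_eq ev_def)
    ultimately show ?thesis
      by (simp add: \<sigma>_def)
  qed
  have mult: "\<sigma> (x * y) = \<sigma> x * \<sigma> y" and add: "\<sigma> (x + y) = \<sigma> x + \<sigma> y"
    if xy: "x \<in> rat_adjoin {\<zeta>}" "y \<in> rat_adjoin {\<zeta>}" for x y
  proof -
    obtain q r where "x = ev q \<zeta>" "y = ev r \<zeta>"
      using xy unfolding cyclotomic_field_eq ev_def by blast
    thus "\<sigma> (x * y) = \<sigma> x * \<sigma> y" "\<sigma> (x + y) = \<sigma> x + \<sigma> y"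
      using \<sigma>[of "q * r"] \<sigma>[of "q + r"] \<sigma>[of q] \<sigma>[of r]
      by (simp_all add: ev_def poly_of_rat_mult poly_of_rat_add)
  qed
  have "\<sigma> 1 = 1" "\<sigma> \<zeta> = z"
    using \<sigma>[of 1] \<sigma>[of "[:0, 1:]"] by (simp_all add: ev_def map_poly_pCons)
  hence "\<sigma> \<in> embeddings (rat_adjoin {\<zeta>})"
    using mult add by (simp add: embeddings_def subring_of_hom_iff \<sigma>_def)
  thus thesis
    using that \<open>\<sigma> \<zeta> = z\<close> by blast
qed

text \<open>An injective homomorphism preserves exact multiplicative orders.\<close>

lemma cyclotomic_embedding_primitive:
  assumes "\<sigma> \<in> embeddings (rat_adjoin {\<zeta>})"
  shows "primitive_root_of_unity l (\<sigma> \<zeta>)"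
proof (rule primitive_rootI)
  note hom = embeddings_hom[OF assms]
  fix n
  have "\<sigma> \<zeta> ^ n = \<sigma> (\<zeta> ^ n)"
    using emb_power[OF hom cyclotomic_gen] by simp
  hence "\<sigma> \<zeta> ^ n = 1 \<longleftrightarrow> \<sigma> (\<zeta> ^ n) = \<sigma> 1"
    using emb_one[OF hom] by simp
  also have "\<dots> \<longleftrightarrow> \<zeta> ^ n = 1"
    using emb_inj[OF hom] by (intro inj_on_eq_iff) (auto intro: rat_adjoin_power cyclotomic_gen rat_adjoin_one)
  finally show "\<sigma> \<zeta> ^ n = 1 \<longleftrightarrow> l dvd n"
    by (simp add: primitive_root_power_eq_1_iff[OF prim])
qed (rule primitive_rootD(1)[OF prim])

lemma cyclotomic_embedding_eqI:
  assumes "\<sigma> \<in> embeddings (rat_adjoin {\<zeta>})" "\<tau> \<in> embeddings (rat_adjoin {\<zeta>})" "\<sigma> \<zeta> = \<tau> \<zeta>"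
  shows "\<sigma> = \<tau>"
  using assms by (intro embeddings_eqI[of \<sigma> "{\<zeta>}" \<tau>]) auto

lemma bij_betw_cyclotomic_embeddings:
  "bij_betw (\<lambda>\<sigma>. \<sigma> \<zeta>) (embeddings (rat_adjoin {\<zeta>})) {z. primitive_root_of_unity l z}"
  unfolding bij_betw_def
  by (auto intro!: inj_onI cyclotomic_embedding_eqI cyclotomic_embedding_primitive
      elim: cyclotomic_embedding_exists)

lemma finite_cyclotomic_embeddings: "finite (embeddings (rat_adjoin {\<zeta>}))"
proof -
  have "{z. primitive_root_of_unity l z} \<subseteq> {z. z ^ l = 1}"
    by (auto dest: primitive_rootD)
  moreover have "finite {z::complex. z ^ l = 1}"
    using primitive_rootD(1)[OF prim] by (intro finite_roots_unity) simp
  ultimately show ?thesis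
    using bij_betw_finite[OF bij_betw_cyclotomic_embeddings] finite_subset by blast
qed

text \<open>Both \<zeta> and its image are primitive, so each is a power of the other. Hence the
  image of the field lies in the field and contains it.\<close>

lemma cyclotomic_embedding_surj:
  assumes \<sigma>: "\<sigma> \<in> embeddings (rat_adjoin {\<zeta>})"
  shows "bij_betw \<sigma> (rat_adjoin {\<zeta>}) (rat_adjoin {\<zeta>})"
proof -
  note hom = embeddings_hom[OF \<sigma>]
  have pr: "primitive_root_of_unity l (\<sigma> \<zeta>)"
    by (rule cyclotomic_embedding_primitive[OF \<sigma>])
  obtain d where d: "\<sigma> \<zeta> = \<zeta> ^ d"
    using primitive_rootE[OF prim pr] by blast
  obtain e where e: "\<zeta> = \<sigma> \<zeta> ^ e"
    using primitive_rootE[OF pr prim] by blast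
  have "\<sigma> ` rat_adjoin {\<zeta>} \<subseteq> rat_adjoin {\<zeta>}"
  proof
    fix y assume "y \<in> \<sigma> ` rat_adjoin {\<zeta>}"
    then obtain q where "y = \<sigma> (poly (map_poly of_rat q) \<zeta>)"
      unfolding cyclotomic_field_eq by blast
    hence "y = poly (map_poly of_rat q) (\<zeta> ^ d)"
      using emb_poly[OF hom cyclotomic_gen] d by simp
    thus "y \<in> rat_adjoin {\<zeta>}"
      by (simp add: rat_adjoin_poly rat_adjoin_power cyclotomic_gen)
  qed
  moreover have "rat_adjoin {\<zeta>} \<subseteq> \<sigma> ` rat_adjoin {\<zeta>}"
  proof
    fix y assume "y \<in> rat_adjoin {\<zeta>}"
    then obtain q where "y = poly (map_poly of_rat q) \<zeta>"
      unfolding cyclotomic_field_eq by blast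
    also have "\<zeta> = \<sigma> (\<zeta> ^ e)"
      using emb_power[OF hom cyclotomic_gen] e by simp
    also have "poly (map_poly of_rat q) (\<sigma> (\<zeta> ^ e)) = \<sigma> (poly (map_poly of_rat q) (\<zeta> ^ e))"
      using emb_poly[OF hom rat_adjoin_power[OF cyclotomic_gen]] by simp
    finally show "y \<in> \<sigma> ` rat_adjoin {\<zeta>}"
      by (auto intro!: imageI rat_adjoin_poly rat_adjoin_power cyclotomic_gen)
  qed
  ultimately show ?thesis
    using emb_inj[OF hom] by (simp add: bij_betw_def)
qed

text \<open>Identifies the index set of the sum defining \<open>rational_idempotent\<close> with
  that of \<open>field_trace\<close>.\<close>

lemma carrier_cyclotomic_Gal: "carrier (Gal (rat_adjoin {\<zeta>}) \<rat>) = embeddings (rat_adjoin {\<zeta>})"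
  by (auto simp: carrier_Gal cyclotomic_embedding_surj emb_rat[OF embeddings_hom])

text \<open>If \<open>m\<close> is the value of \<open>q\<close> at \<zeta>, its trace is the sum of
  \<open>q\<close> over all primitive \<open>l\<close>-th roots of unity, a rational combination of
  Ramanujan sums.\<close>

lemma cyclotomic_trace_Rats:
  assumes "m \<in> rat_adjoin {\<zeta>}"
  shows "field_trace (rat_adjoin {\<zeta>}) m \<in> \<rat>"
proof -
  obtain q where q: "m = poly (map_poly of_rat q) \<zeta>"
    using assms unfolding cyclotomic_field_eq by blast
  have "field_trace (rat_adjoin {\<zeta>}) m
      = (\<Sum>\<sigma>\<in>embeddings (rat_adjoin {\<zeta>}). poly (map_poly of_rat q) (\<sigma> \<zeta>))"
    unfolding field_trace_def q
    by (intro sum.cong refl emb_poly[OF embeddings_hom cyclotomic_gen])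
  also have "\<dots> = (\<Sum>z | primitive_root_of_unity l z. poly (map_poly of_rat q) z)"
    by (rule sum.reindex_bij_betw[OF bij_betw_cyclotomic_embeddings])
  also have "\<dots> = (\<Sum>i\<le>degree q. of_rat (poly.coeff q i) * (\<Sum>z | primitive_root_of_unity l z. z ^ i))"
    by (simp add: poly_altdef coeff_map_poly sum_distrib_left) (rule sum.swap)
  also have "\<dots> \<in> \<rat>"
    using primitive_rootD(1)[OF prim]
    by (intro Rats_sum Rats_mult sum_primitive_roots_power_Rats) auto
  finally show ?thesis .
qed

end

section \<open>Linear characters\<close>

lemma sum_fun_apply: "(\<Sum>i\<in>A. f i) x = (\<Sum>i\<in>A. f i x)"
  for f :: "'i \<Rightarrow> 'a \<Rightarrow> complex"
  by (induction A rule: infinite_finite_induct) simp_all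

lemma sum_ga_of_apply:
  assumes "finite A"
  shows "(\<Sum>g\<in>A. ga_scale (c g) (ga_of g)) x = (if x \<in> A then c x else 0)"
  using assms by (simp add: sum_fun_apply ga_scale_def ga_of_def if_distrib cong: if_cong)

lemma root_of_unity_cnj:
  fixes z :: complex
  assumes "l > 0" "z ^ l = 1"
  shows "cnj z = inverse z"
proof -
  have "norm z ^ l = 1"
    using assms(2) by (metis norm_one norm_power)
  hence "norm z = 1"
    using assms(1) power_eq_imp_eq_base[of "norm z" l 1] by simp
  hence "z * cnj z = 1"
    using complex_norm_square[of z] by simp
  thus ?thesis
    by (metis inverse_unique)
qed

definition linear_character :: "('g, 'b) monoid_scheme \<Rightarrow> ('g \<Rightarrow> complex) \<Rightarrow> bool" where
  "linear_character G \<psi> \<longleftrightarrow> \<psi> \<one>\<^bsub>G\<^esub> = 1 \<and>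
     (\<forall>g\<in>carrier G. \<forall>h\<in>carrier G. \<psi> (g \<otimes>\<^bsub>G\<^esub> h) = \<psi> g * \<psi> h)"

text \<open>The trace of the identity matrix is the dimension, so the representing matrices have
  size 1; the trace of such a matrix is its only entry, and these entries multiply.\<close>

lemma irreducible_character_linear:
  assumes "group G" "irreducible_character G \<chi>" "\<chi> \<one>\<^bsub>G\<^esub> = 1"
  shows "linear_character G \<chi>"
proof -
  interpret group G by fact
  obtain n \<rho> where rep: "representation G n \<rho>" and tr: "\<forall>g\<in>carrier G. \<chi> g = mat_trace (\<rho> g)"
    using assms(2) unfolding irreducible_character_def irreducible_representation_def by blast
  have "of_nat n = (1 :: complex)"
    using tr rep assms(3) by (simp add: representation_def mat_trace_def)
  hence n: "n = 1"
    by (metis of_nat_1 of_nat_eq_iff)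
  have car: "\<rho> g \<in> carrier_mat 1 1" if "g \<in> carrier G" for g
    using rep that by (simp add: representation_def n)
  have val: "\<chi> g = \<rho> g $$ (0, 0)" if "g \<in> carrier G" for g
    using car[OF that] tr that by (simp add: mat_trace_def)
  have "\<chi> (g \<otimes>\<^bsub>G\<^esub> h) = \<chi> g * \<chi> h" if gh: "g \<in> carrier G" "h \<in> carrier G" for g h
  proof -
    have "\<rho> (g \<otimes>\<^bsub>G\<^esub> h) = \<rho> g * \<rho> h"
      using rep gh by (simp add: representation_def)
    thus ?thesis
      using car[OF gh(1)] car[OF gh(2)] gh by (simp add: val scalar_prod_def)
  qed
  thus ?thesis
    using assms(3) by (simp add: linear_character_def)
qed

locale finite_group = group G for G (structure) +
  assumes finite_carrier: "finite (carrier G)"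
begin

lemma sum_left_translate:
  assumes "x \<in> carrier G"
  shows "(\<Sum>g\<in>carrier G. f (x \<otimes> g)) = (\<Sum>g\<in>carrier G. f g :: complex)"
  using assms
  by (intro sum.reindex_bij_witness[of _ "\<lambda>g. inv x \<otimes> g" "\<lambda>g. x \<otimes> g"])
    (auto simp: m_assoc[symmetric])

lemma order_pos: "order G > 0"
  using finite_carrier by (simp add: order_gt_0_iff_finite)

lemma linear_character_mult:
  "linear_character G \<psi> \<Longrightarrow> g \<in> carrier G \<Longrightarrow> h \<in> carrier G \<Longrightarrow> \<psi> (g \<otimes> h) = \<psi> g * \<psi> h"
  by (simp add: linear_character_def)

lemma linear_character_nz:
  assumes "linear_character G \<psi>" "g \<in> carrier G"
  shows "\<psi> g \<noteq> 0"
proof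
  assume "\<psi> g = 0"
  hence "\<psi> (g \<otimes> inv g) = 0"
    using assms linear_character_mult[OF assms, of "inv g"] by (simp del: r_inv)
  thus False
    using assms by (simp add: linear_character_def)
qed

lemma linear_character_inv:
  assumes "linear_character G \<psi>" "g \<in> carrier G"
  shows "\<psi> (inv g) = inverse (\<psi> g)"
proof -
  have "\<psi> g * \<psi> (inv g) = 1"
    using assms linear_character_mult[of \<psi> g "inv g"] by (simp add: linear_character_def)
  thus ?thesis
    by (simp add: inverse_unique)
qed

text \<open>By Lagrange's theorem the image, of size \<open>n\<close>, lies in the \<open>n\<close>-th roots of unity, of which there are
  only \<open>n\<close>.\<close>

lemma linear_character_image:
  assumes "linear_character G \<psi>"
  shows "\<psi> ` carrier G = {z. z ^ char_order G \<psi> = 1}" "char_order G \<psi> > 0"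
proof -
  define H where "H = \<psi> ` carrier G"
  define n where "n = card H"
  have "finite H" "H \<noteq> {}"
    by (auto simp: H_def finite_carrier)
  hence "n > 0"
    by (auto simp: n_def card_gt_0_iff)
  have "z ^ n = 1" if zH: "z \<in> H" for z
  proof -
    obtain g where g: "g \<in> carrier G" "z = \<psi> g"
      using zH by (auto simp: H_def)
    have nz: "w \<noteq> 0" if "w \<in> H" for w
      using that linear_character_nz[OF assms] by (auto simp: H_def)
    have "(*) z ` H \<subseteq> H"
    proof
      fix y assume "y \<in> (*) z ` H"
      then obtain h where "h \<in> carrier G" "y = \<psi> g * \<psi> h"
        using g by (auto simp: H_def)
      thus "y \<in> H"
        using g linear_character_mult[OF assms g(1), of h] by (auto simp: H_def intro!: image_eqI[of _ _ "g \<otimes> h"])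
    qed
    moreover have inj: "inj_on ((*) z) H"
      using nz[OF zH] by (auto simp: inj_on_def)
    ultimately have "(*) z ` H = H"
      using \<open>finite H\<close> by (intro endo_inj_surj) auto
    \<comment> \<open>Multiplication by \<open>z\<close> permutes \<open>H\<close>, so the product
      over \<open>H\<close> is unchanged by it, and the resulting factor \<open>z ^ n\<close> must
      be 1.\<close>
    hence "prod (\<lambda>w. w) H = (\<Prod>w\<in>H. z * w)"
      using prod.reindex[OF inj, of "\<lambda>w. w"] by simp
    also have "\<dots> = z ^ n * prod (\<lambda>w. w) H"
      by (simp add: prod.distrib n_def)
    finally show ?thesis
      using nz \<open>finite H\<close> by simp
  qed
  hence "H \<subseteq> {z. z ^ n = 1}"
    by auto
  moreover have "card H = card {z::complex. z ^ n = 1}"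
    using \<open>n > 0\<close> by (simp add: card_roots_unity_eq n_def)
  ultimately have H: "H = {z. z ^ n = 1}"
    using \<open>n > 0\<close> by (intro card_subset_eq finite_roots_unity) auto
  have "char_order G \<psi> = n"
    unfolding char_order_def
  proof (rule Least_equality)
    show "n > 0 \<and> (\<forall>g\<in>carrier G. \<psi> g ^ n = 1)"
      using \<open>n > 0\<close> H by (auto simp: H_def)
    fix k assume k: "0 < k \<and> (\<forall>g\<in>carrier G. \<psi> g ^ k = 1)"
    hence "H \<subseteq> {z. z ^ k = 1}"
      by (auto simp: H_def)
    \<comment> \<open>Minimality of \<open>n\<close>: the \<open>k\<close>-th roots of unity, only
      \<open>k\<close> in number, would have to contain all \<open>n\<close> values.\<close>
    hence "card H \<le> card {z::complex. z ^ k = 1}"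
      using k by (intro card_mono finite_roots_unity) auto
    thus "n \<le> k"
      using k by (simp add: n_def card_roots_unity_eq)
  qed
  thus "\<psi> ` carrier G = {z. z ^ char_order G \<psi> = 1}" "char_order G \<psi> > 0"
    using H \<open>n > 0\<close> by (auto simp: H_def)
qed

lemma ga_mult_apply:
  "ga_mult G M N x = (if x \<in> carrier G then \<Sum>g\<in>carrier G. M g * N (inv g \<otimes> x) else 0)"
proof -
  have "ga_mult G M N x
      = (\<Sum>g\<in>carrier G. \<Sum>h\<in>carrier G. M g * N h * (if x = g \<otimes> h then 1 else 0))"
    by (simp add: ga_mult_def sum_fun_apply ga_scale_def ga_of_def)
  also have "\<dots> = (\<Sum>g\<in>carrier G. if x \<in> carrier G then M g * N (inv g \<otimes> x) else 0)"
  proof (rule sum.cong[OF refl])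
    fix g assume g: "g \<in> carrier G"
    have "(\<Sum>h\<in>carrier G. M g * N h * (if x = g \<otimes> h then 1 else 0))
        = (\<Sum>h\<in>carrier G. if h = inv g \<otimes> x \<and> x \<in> carrier G then M g * N h else 0)"
    proof (rule sum.cong[OF refl])
      fix h assume h: "h \<in> carrier G"
      \<comment> \<open>Membership of \<open>x\<close> is recorded explicitly because the group
        operation is unspecified outside the carrier.\<close>
      have "x = g \<otimes> h \<longleftrightarrow> h = inv g \<otimes> x \<and> x \<in> carrier G"
        using g h by (auto simp: m_assoc[symmetric])
      thus "M g * N h * (if x = g \<otimes> h then 1 else 0)
          = (if h = inv g \<otimes> x \<and> x \<in> carrier G then M g * N h else 0)"
        by simp
    qed
    also have "\<dots> = (if x \<in> carrier G then M g * N (inv g \<otimes> x) else 0)"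
      using g finite_carrier by simp
    finally show "(\<Sum>h\<in>carrier G. M g * N h * (if x = g \<otimes> h then 1 else 0))
        = (if x \<in> carrier G then M g * N (inv g \<otimes> x) else 0)" .
  qed
  finally show ?thesis
    by simp
qed

lemma central_idempotent_apply:
  assumes "linear_character G \<psi>"
  shows "central_idempotent G \<psi> x = (if x \<in> carrier G then cnj (\<psi> x) / of_nat (order G) else 0)"
  using assms finite_carrier
  by (simp add: central_idempotent_def ga_scale_def[of "_ / _"] sum_ga_of_apply linear_character_def)

lemma linear_character_cnj:
  assumes "linear_character G \<psi>" "g \<in> carrier G"
  shows "cnj (\<psi> g) = inverse (\<psi> g)"
  using linear_character_image[OF assms(1)] assms(2) by (intro root_of_unity_cnj) auto

text \<open>For equal characters every term is 1. Otherwise translation by some \<open>h\<close>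
  with \<open>\<psi> h \<noteq> \<phi> h\<close> multiplies the sum by
  \<open>cnj (\<psi> h) * \<phi> h\<close>, which is not 1, so the sum vanishes.\<close>

lemma linear_character_orthogonal:
  assumes "linear_character G \<psi>" "linear_character G \<phi>"
  shows "(\<Sum>g\<in>carrier G. cnj (\<psi> g) * \<phi> g) = (if \<forall>g\<in>carrier G. \<psi> g = \<phi> g then of_nat (order G) else 0)"
proof (cases "\<forall>g\<in>carrier G. \<psi> g = \<phi> g")
  case True
  hence "cnj (\<psi> g) * \<phi> g = 1" if "g \<in> carrier G" for g
    using linear_character_cnj[OF assms(2) that] linear_character_nz[OF assms(2) that] that by simp
  thus ?thesis
    using True by (simp add: order_def)
next
  case False
  then obtain h where h: "h \<in> carrier G" "\<psi> h \<noteq> \<phi> h"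
    by blast
  define s where "s = (\<Sum>g\<in>carrier G. cnj (\<psi> g) * \<phi> g)"
  have "s = (\<Sum>g\<in>carrier G. cnj (\<psi> (h \<otimes> g)) * \<phi> (h \<otimes> g))"
    unfolding s_def by (rule sum_left_translate[OF h(1), symmetric])
  also have "\<dots> = cnj (\<psi> h) * \<phi> h * s"
    unfolding s_def sum_distrib_left using h(1) assms
    by (intro sum.cong refl) (simp add: linear_character_mult ac_simps)
  finally have "\<psi> h * s = \<phi> h * s"
    using linear_character_cnj[OF assms(1) h(1)] linear_character_nz[OF assms(1) h(1)]
    by (simp add: field_simps)
  hence "s = 0"
    using h(2) by simp
  thus ?thesis
    using h by (auto simp: s_def)
qed

end

lemma root_of_unity_powi_cong:
  fixes z :: complex
  assumes "l > 0" "z ^ l = 1" "i mod int l = j mod int l"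
  shows "z powi i = z powi j"
proof -
  have "z \<noteq> 0"
    using assms(1,2) by (auto simp: power_0_left)
  obtain k where "i = j + int l * k"
    using assms(3) by (metis mod_eqE)
  hence "z powi i = z powi j * (z powi int l) powi k"
    using \<open>z \<noteq> 0\<close> by (simp add: power_int_add power_int_mult)
  thus ?thesis
    using assms(2) by simp
qed

lemma id_embedding: "(\<lambda>x\<in>rat_adjoin S. x) \<in> embeddings (rat_adjoin S)"
  by (simp add: embeddings_def subring_of_hom_iff rat_adjoin_one rat_adjoin_add rat_adjoin_mult)

lemma (in vector_space_pair) dim_inj_image_eq:
  assumes lin: "Vector_Spaces.linear s1 s2 f" and inj: "inj_on f (vs1.span S)"
  shows "vs2.dim (f ` S) = vs1.dim S"
proof -
  obtain B where B: "B \<subseteq> S" "vs1.independent B" "S \<subseteq> vs1.span B" "card B = vs1.dim S"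
    by (rule vs1.basis_exists)
  have span: "vs1.span B = vs1.span S"
    using B by (meson vs1.span_eq vs1.span_superset subset_trans)
  have "vs2.span (f ` B) = vs2.span (f ` S)"
    by (simp add: linear_span_image[OF lin] span)
  moreover have "vs2.independent (f ` B)"
    using inj B(2) by (intro linear_independent_injective_image[OF lin]) (simp_all add: span)
  ultimately have "vs2.dim (f ` S) = card (f ` B)"
    by (rule vs2.dim_eq_card)
  also have "\<dots> = card B"
    using inj B(1) vs1.span_superset by (intro card_image) (meson inj_on_subset subset_trans)
  finally show ?thesis
    by (simp add: B(4))
qed

section \<open>Trace elements and the rational ideal of a linear character\<close>

locale linear_character_group = finite_group G for G :: "('g, 'b) monoid_scheme" (structure) +
  fixes \<chi> :: "'g \<Rightarrow> complex" and l :: nat and \<zeta> :: complex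
  assumes lin: "linear_character G \<chi>"
    and l_eq: "l = char_order G \<chi>"
    and prim: "primitive_root_of_unity l \<zeta>"
begin

abbreviation E where "E \<equiv> rat_adjoin {\<zeta>}"

definition trace_element :: "complex \<Rightarrow> 'g \<Rightarrow> complex" where
  "trace_element m = (\<Sum>g\<in>carrier G. ga_scale (field_trace E (m * cnj (\<chi> g))) (ga_of g))"

text \<open>The linear extension of \<chi> to the group algebra, scaled by the group order so that
  it inverts \<open>trace_element\<close> on \<open>E\<close>.\<close>

definition coeff_sum :: "('g \<Rightarrow> complex) \<Rightarrow> complex" where
  "coeff_sum M = (\<Sum>g\<in>carrier G. M g * \<chi> g) / of_nat (order G)"

lemma char_image: "\<chi> ` carrier G = {z. z ^ l = 1}"
  using linear_character_image[OF lin] by (simp add: l_eq)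

lemma char_powers: "\<chi> ` carrier G = (\<lambda>k. \<zeta> ^ k) ` {..<l}"
  by (simp add: char_image roots_of_unity_eq_powers[OF prim])

lemma char_pow_l: "g \<in> carrier G \<Longrightarrow> \<chi> g ^ l = 1"
  using char_image by blast

lemma char_mem: "g \<in> carrier G \<Longrightarrow> \<chi> g \<in> E"
proof -
  assume "g \<in> carrier G"
  then obtain k where "\<chi> g = \<zeta> ^ k"
    using char_powers by blast
  thus ?thesis
    by (simp add: rat_adjoin_power rat_adjoin_incl)
qed

lemma gen_in_image: "\<exists>g\<in>carrier G. \<chi> g = \<zeta>"
proof -
  have "\<zeta> \<in> \<chi> ` carrier G"
    unfolding char_image using primitive_rootD(2)[OF prim] by simp
  thus ?thesis
    by blast
qed

lemma char_field_eq: "char_field G \<chi> = E"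
  unfolding char_field_def
proof (intro equalityI rat_adjoin_minimal)
  show "\<chi> ` carrier G \<subseteq> E"
    using char_mem by blast
  show "{\<zeta>} \<subseteq> rat_adjoin (\<chi> ` carrier G)"
    using gen_in_image by (auto intro: rat_adjoin_incl)
qed

lemma conj_character:
  assumes "\<sigma> \<in> embeddings E"
  shows "linear_character G (\<lambda>g. \<sigma> (\<chi> g))"
  using lin emb_one[OF embeddings_hom[OF assms]] emb_mult[OF embeddings_hom[OF assms]] char_mem
  by (simp add: linear_character_def)

text \<open>Since \<zeta> is a value of \<chi>, agreeing conjugates come from embeddings that agree
  at the generator.\<close>

lemma conj_character_eq_iff:
  assumes "\<sigma> \<in> embeddings E" "\<tau> \<in> embeddings E"
  shows "(\<forall>g\<in>carrier G. \<sigma> (\<chi> g) = \<tau> (\<chi> g)) \<longleftrightarrow> \<sigma> = \<tau>"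
  using gen_in_image cyclotomic_embedding_eqI[OF prim assms] by metis

text \<open>Embeddings commute with complex conjugation on character values, because conjugation is
  inversion there. This turns the trace into a Fourier expansion in the conjugates of
  \<chi>.\<close>

lemma trace_element_apply:
  assumes "m \<in> E"
  shows "trace_element m x
    = (if x \<in> carrier G then \<Sum>\<sigma>\<in>embeddings E. \<sigma> m * cnj (\<sigma> (\<chi> x)) else 0)"
proof -
  have "\<sigma> (m * cnj (\<chi> x)) = \<sigma> m * cnj (\<sigma> (\<chi> x))"
    if "\<sigma> \<in> embeddings E" "x \<in> carrier G" for \<sigma>
  proof -
    note hom = embeddings_hom[OF that(1)]
    have "\<sigma> (m * cnj (\<chi> x)) = \<sigma> m * inverse (\<sigma> (\<chi> x))"
      using emb_mult[OF hom assms rat_adjoin_inverse[OF char_mem[OF that(2)]]]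
        emb_inverse[OF hom char_mem[OF that(2)]] linear_character_cnj[OF lin that(2)] by simp
    thus ?thesis
      using linear_character_cnj[OF conj_character[OF that(1)] that(2)] by simp
  qed
  thus ?thesis
    unfolding trace_element_def using finite_carrier by (simp add: sum_ga_of_apply field_trace_def)
qed

text \<open>After exchanging the sums, orthogonality of distinct conjugates leaves only the term at
  \<tau>.\<close>

lemma fourier_inversion:
  assumes "\<tau> \<in> embeddings E"
  shows "(\<Sum>x\<in>carrier G. (\<Sum>\<sigma>\<in>embeddings E. c \<sigma> * cnj (\<sigma> (\<chi> x))) * \<tau> (\<chi> x)) = of_nat (order G) * c \<tau>"
proof -
  have "(\<Sum>x\<in>carrier G. (\<Sum>\<sigma>\<in>embeddings E. c \<sigma> * cnj (\<sigma> (\<chi> x))) * \<tau> (\<chi> x))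
      = (\<Sum>\<sigma>\<in>embeddings E. c \<sigma> * (\<Sum>x\<in>carrier G. cnj (\<sigma> (\<chi> x)) * \<tau> (\<chi> x)))"
    by (simp add: sum_distrib_left sum_distrib_right mult.assoc) (rule sum.swap)
  also have "\<dots> = (\<Sum>\<sigma>\<in>embeddings E. if \<sigma> = \<tau> then c \<sigma> * of_nat (order G) else 0)"
    using linear_character_orthogonal[OF conj_character conj_character[OF assms]]
      conj_character_eq_iff[OF _ assms] by (intro sum.cong refl) simp
  also have "\<dots> = of_nat (order G) * c \<tau>"
    using assms finite_cyclotomic_embeddings[OF prim] by simp
  finally show ?thesis .
qed

text \<open>This is \<open>fourier_inversion\<close> at the identity embedding.\<close>

lemma coeff_sum_trace_element:
  assumes "m \<in> E"
  shows "coeff_sum (trace_element m) = m"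
proof -
  have "(\<Sum>g\<in>carrier G. trace_element m g * \<chi> g)
      = (\<Sum>g\<in>carrier G. (\<Sum>\<sigma>\<in>embeddings E. \<sigma> m * cnj (\<sigma> (\<chi> g))) * (\<lambda>x\<in>E. x) (\<chi> g))"
    using assms by (intro sum.cong refl) (simp add: trace_element_apply char_mem)
  also have "\<dots> = of_nat (order G) * m"
    using fourier_inversion[OF id_embedding, of "\<lambda>\<sigma>. \<sigma> m"] assms by simp
  finally show ?thesis
    using order_pos by (simp add: coeff_sum_def)
qed

lemma trace_element_rat: "m \<in> E \<Longrightarrow> trace_element m \<in> rat_group_algebra G"
  using finite_carrier
  by (auto simp: rat_group_algebra_def trace_element_def sum_ga_of_apply linear_character_cnj[OF lin]
      intro!: cyclotomic_trace_Rats[OF prim] rat_adjoin_mult rat_adjoin_inverse char_mem)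

lemma rat_group_algebra_coeff_mem: "M \<in> rat_group_algebra G \<Longrightarrow> g \<in> carrier G \<Longrightarrow> M g \<in> E"
  using rat_adjoin_of_rat by (fastforce simp: rat_group_algebra_def elim!: Rats_cases)

lemma coeff_sum_mem:
  assumes "M \<in> rat_group_algebra G"
  shows "coeff_sum M \<in> E"
  unfolding coeff_sum_def divide_inverse
  by (intro rat_adjoin_mult rat_adjoin_sum rat_adjoin_inverse rat_adjoin_of_nat
      rat_group_algebra_coeff_mem[OF assms] char_mem)

text \<open>Convolution with the idempotent of the \<sigma>-conjugate gives
  \<open>cnj (\<sigma> (\<chi> x))\<close> times the average of
  \<open>M g * \<sigma> (\<chi> g)\<close>. As \<open>M\<close> is rational, \<sigma> fixes its
  coefficients and this average is \<open>\<sigma> (coeff_sum M)\<close>, so the sum over \<sigma>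
  is a trace.\<close>

lemma mult_rational_idempotent:
  assumes M: "M \<in> rat_group_algebra G"
  shows "ga_mult G M (rational_idempotent G \<chi>) = trace_element (coeff_sum M)"
proof
  fix x
  show "ga_mult G M (rational_idempotent G \<chi>) x = trace_element (coeff_sum M) x"
  proof (cases "x \<in> carrier G")
    case x: True
    have idem: "rational_idempotent G \<chi> y
        = (\<Sum>\<sigma>\<in>embeddings E. cnj (\<sigma> (\<chi> y)) / of_nat (order G))" if "y \<in> carrier G" for y
      using that by (simp add: rational_idempotent_def char_Gal_def char_field_eq
          carrier_cyclotomic_Gal[OF prim] sum_fun_apply central_idempotent_apply[OF conj_character])
    have conv: "cnj (\<sigma> (\<chi> (inv g \<otimes> x))) = \<sigma> (\<chi> g) * cnj (\<sigma> (\<chi> x))"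
      if "\<sigma> \<in> embeddings E" "g \<in> carrier G" for \<sigma> g
    proof -
      note c = conj_character[OF that(1)]
      have "\<sigma> (\<chi> (inv g \<otimes> x)) = inverse (\<sigma> (\<chi> g)) * \<sigma> (\<chi> x)"
        using linear_character_mult[OF c] linear_character_inv[OF c] that(2) x by simp
      also have "inverse (\<sigma> (\<chi> g)) = cnj (\<sigma> (\<chi> g))"
        using linear_character_cnj[OF c that(2)] by simp
      finally show ?thesis
        by simp
    qed
    have coeff: "\<sigma> (coeff_sum M) = (\<Sum>g\<in>carrier G. M g * \<sigma> (\<chi> g)) / of_nat (order G)"
      if "\<sigma> \<in> embeddings E" for \<sigma>
    proof -
      note hom = embeddings_hom[OF that]
      have Mg: "M g \<in> E" "\<sigma> (M g) = M g" if "g \<in> carrier G" for g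
        using M that emb_rat[OF hom] rat_group_algebra_coeff_mem[OF M]
        by (simp_all add: rat_group_algebra_def)
      have sum: "(\<Sum>g\<in>carrier G. M g * \<chi> g) \<in> E"
        by (intro rat_adjoin_sum rat_adjoin_mult Mg char_mem)
      have "\<sigma> (coeff_sum M) = \<sigma> (\<Sum>g\<in>carrier G. M g * \<chi> g) * inverse (of_nat (order G))"
        unfolding coeff_sum_def divide_inverse
        using emb_mult[OF hom sum rat_adjoin_inverse[OF rat_adjoin_of_nat]]
          emb_inverse[OF hom rat_adjoin_of_nat] emb_of_nat[OF hom] by simp
      also have "\<sigma> (\<Sum>g\<in>carrier G. M g * \<chi> g) = (\<Sum>g\<in>carrier G. \<sigma> (M g * \<chi> g))"
        by (rule emb_sum[OF hom rat_adjoin_mult[OF Mg(1) char_mem]])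
      also have "\<dots> = (\<Sum>g\<in>carrier G. M g * \<sigma> (\<chi> g))"
        using emb_mult[OF hom Mg(1) char_mem] Mg(2) by (intro sum.cong refl) simp
      finally show ?thesis
        by (simp add: divide_inverse)
    qed
    have "ga_mult G M (rational_idempotent G \<chi>) x
        = (\<Sum>g\<in>carrier G. M g * rational_idempotent G \<chi> (inv g \<otimes> x))"
      using x by (simp add: ga_mult_apply)
    also have "\<dots> = (\<Sum>g\<in>carrier G. \<Sum>\<sigma>\<in>embeddings E.
        M g * \<sigma> (\<chi> g) * cnj (\<sigma> (\<chi> x)) / of_nat (order G))"
      using x by (intro sum.cong refl) (simp add: idem conv sum_distrib_left mult.assoc)
    also have "\<dots> = (\<Sum>\<sigma>\<in>embeddings E. \<sigma> (coeff_sum M) * cnj (\<sigma> (\<chi> x)))"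
      by (subst sum.swap) (simp add: coeff sum_distrib_right sum_divide_distrib)
    finally show ?thesis
      using x by (simp add: trace_element_apply coeff_sum_mem[OF M])
  next
    case False
    thus ?thesis
      by (simp add: ga_mult_apply trace_element_apply coeff_sum_mem[OF M])
  qed
qed

text \<open>A fixed \<open>M\<close> equals \<open>trace_element (coeff_sum M)\<close>; conversely
  \<open>trace_element m\<close> is fixed because \<open>coeff_sum\<close> returns
  \<open>m\<close>.\<close>

lemma rat_ideal_eq:
  "{M \<in> rat_group_algebra G. M = ga_mult G M (rational_idempotent G \<chi>)} = trace_element ` E"
  using coeff_sum_mem mult_rational_idempotent trace_element_rat coeff_sum_trace_element
  by (auto intro!: image_eqI)

text \<open>The product is again a Fourier sum over the conjugates, with coefficients
  \<open>\<sigma> m * s \<sigma>\<close>; by \<open>fourier_inversion\<close> it vanishes only if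
  each of them does.\<close>

lemma trace_element_annihilates_iff:
  assumes m: "m \<in> E"
  shows "ga_mult G (trace_element m) (\<Sum>g\<in>carrier G. ga_scale (a g) (ga_of (inv g))) = 0 \<longleftrightarrow>
    (\<forall>\<sigma>\<in>embeddings E. \<sigma> m * (\<Sum>g\<in>carrier G. cnj (\<sigma> (\<chi> g)) * a g) = 0)"
proof -
  define N where "N = (\<Sum>g\<in>carrier G. ga_scale (a g) (ga_of (inv g)))"
  define s where "s = (\<lambda>\<sigma>. \<Sum>g\<in>carrier G. cnj (\<sigma> (\<chi> g)) * a g)"
  have N: "N y = a (inv y)" if "y \<in> carrier G" for y
  proof -
    have "N y = (\<Sum>g\<in>carrier G. if g = inv y then a g else 0)"
      unfolding N_def sum_fun_apply ga_scale_def ga_of_def using that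
      by (intro sum.cong refl) auto
    thus ?thesis
      using that finite_carrier by simp
  qed
  have conv: "ga_mult G (trace_element m) N x = (\<Sum>\<sigma>\<in>embeddings E. \<sigma> m * s \<sigma> * cnj (\<sigma> (\<chi> x)))"
    if x: "x \<in> carrier G" for x
  proof -
    have "ga_mult G (trace_element m) N x
        = (\<Sum>g\<in>carrier G. trace_element m g * a (inv x \<otimes> g))"
      using x by (simp add: ga_mult_apply N inv_mult_group)
    \<comment> \<open>Translating the summation variable by \<open>x\<close> frees the argument of
      \<open>a\<close> from \<open>x\<close>; multiplicativity then splits off the factor at
      \<open>x\<close>.\<close>
    also have "\<dots> = (\<Sum>g\<in>carrier G. trace_element m (x \<otimes> g) * a (inv x \<otimes> (x \<otimes> g)))"
      by (rule sum_left_translate[OF x, symmetric])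
    also have "\<dots> = (\<Sum>g\<in>carrier G. \<Sum>\<sigma>\<in>embeddings E. \<sigma> m * (cnj (\<sigma> (\<chi> g)) * a g) * cnj (\<sigma> (\<chi> x)))"
    proof (rule sum.cong[OF refl])
      fix g assume g: "g \<in> carrier G"
      have "inv x \<otimes> (x \<otimes> g) = g"
        using x g by (simp add: m_assoc[symmetric])
      moreover have "cnj (\<sigma> (\<chi> (x \<otimes> g))) = cnj (\<sigma> (\<chi> x)) * cnj (\<sigma> (\<chi> g))"
        if "\<sigma> \<in> embeddings E" for \<sigma>
        using linear_character_mult[OF conj_character[OF that] x g] by simp
      ultimately show "trace_element m (x \<otimes> g) * a (inv x \<otimes> (x \<otimes> g))
          = (\<Sum>\<sigma>\<in>embeddings E. \<sigma> m * (cnj (\<sigma> (\<chi> g)) * a g) * cnj (\<sigma> (\<chi> x)))"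
        using x g m by (simp add: trace_element_apply sum_distrib_left sum_distrib_right ac_simps)
    qed
    also have "\<dots> = (\<Sum>\<sigma>\<in>embeddings E. \<sigma> m * s \<sigma> * cnj (\<sigma> (\<chi> x)))"
      by (subst sum.swap) (simp add: s_def sum_distrib_left sum_distrib_right)
    finally show ?thesis .
  qed
  have "ga_mult G (trace_element m) N = 0 \<longleftrightarrow> (\<forall>\<sigma>\<in>embeddings E. \<sigma> m * s \<sigma> = 0)"
  proof
    assume zero: "ga_mult G (trace_element m) N = 0"
    show "\<forall>\<sigma>\<in>embeddings E. \<sigma> m * s \<sigma> = 0"
    proof
      fix \<tau> assume "\<tau> \<in> embeddings E"
      from fourier_inversion[OF this, of "\<lambda>\<sigma>. \<sigma> m * s \<sigma>"]
      have "of_nat (order G) * (\<tau> m * s \<tau>) = 0"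
        using zero by (simp flip: conv)
      thus "\<tau> m * s \<tau> = 0"
        using order_pos by simp
    qed
  next
    assume "\<forall>\<sigma>\<in>embeddings E. \<sigma> m * s \<sigma> = 0"
    thus "ga_mult G (trace_element m) N = 0"
      using conv by (auto simp: fun_eq_iff ga_mult_apply)
  qed
  thus ?thesis
    by (simp add: N_def s_def)
qed

text \<open>An embedding taking \<zeta> to \<open>\<zeta> ^ e\<close> raises each character value to
  the power \<open>e\<close>, and conjugation negates the exponent. As embeddings realise every
  residue \<open>e\<close> coprime to \<open>l\<close>, so do the exponents
  \<open>- int e\<close>.\<close>

lemma conj_sums_vanish_iff:
  "(\<forall>\<sigma>\<in>embeddings E. (\<Sum>g\<in>carrier G. cnj (\<sigma> (\<chi> g)) * a g) = 0) \<longleftrightarrow>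
    (\<forall>d::int. coprime d (int l) \<longrightarrow> (\<Sum>g\<in>carrier G. \<chi> g powi d * a g) = 0)"
proof -
  note l = primitive_rootD(1)[OF prim]
  have conv: "cnj (\<sigma> (\<chi> g)) = \<chi> g powi (- int e)"
    if "\<sigma> \<in> embeddings E" "\<sigma> \<zeta> = \<zeta> ^ e" "g \<in> carrier G" for \<sigma> e g
  proof -
    have "\<chi> g \<in> (\<lambda>k. \<zeta> ^ k) ` {..<l}"
      using char_powers that(3) by blast
    then obtain k where k: "\<chi> g = \<zeta> ^ k"
      by blast
    have "\<sigma> (\<chi> g) = (\<zeta> ^ e) ^ k"
      using emb_power[OF embeddings_hom[OF that(1)] cyclotomic_gen[OF prim]] k that(2) by simp
    also have "\<dots> = \<chi> g ^ e"
      by (simp add: k mult.commute flip: power_mult)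
    finally show ?thesis
      using linear_character_cnj[OF conj_character[OF that(1)] that(3)] by (simp add: power_int_minus)
  qed
  show ?thesis
  proof (intro iffI allI ballI impI)
    fix \<sigma> assume vanish: "\<forall>d::int. coprime d (int l) \<longrightarrow> (\<Sum>g\<in>carrier G. \<chi> g powi d * a g) = 0"
      and \<sigma>: "\<sigma> \<in> embeddings E"
    obtain e where e: "\<sigma> \<zeta> = \<zeta> ^ e" "coprime e l"
      using primitive_rootE[OF prim cyclotomic_embedding_primitive[OF prim \<sigma>]] by blast
    have "(\<Sum>g\<in>carrier G. \<chi> g powi (- int e) * a g) = 0"
      using vanish e(2) by simp
    thus "(\<Sum>g\<in>carrier G. cnj (\<sigma> (\<chi> g)) * a g) = 0"
      by (simp add: conv[OF \<sigma> e(1)])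
  next
    fix d :: int
    assume vanish: "\<forall>\<sigma>\<in>embeddings E. (\<Sum>g\<in>carrier G. cnj (\<sigma> (\<chi> g)) * a g) = 0"
      and d: "coprime d (int l)"
    \<comment> \<open>The least nonnegative residue of \<open>- d\<close>; the sign compensates for
      the conjugation.\<close>
    define e where "e = nat (- d mod int l)"
    have e: "int e = - d mod int l"
      using l by (simp add: e_def)
    have "coprime (int e) (int l)"
      unfolding e using d l by (simp add: coprime_mod_left_iff)
    hence "primitive_root_of_unity l (\<zeta> ^ e)"
      by (simp add: primitive_root_power_iff[OF prim])
    then obtain \<sigma> where \<sigma>: "\<sigma> \<in> embeddings E" "\<sigma> \<zeta> = \<zeta> ^ e"
      using cyclotomic_embedding_exists[OF prim] by blast
    have "\<chi> g powi d = \<chi> g powi (- int e)" if "g \<in> carrier G" for g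
      by (rule root_of_unity_powi_cong[OF l char_pow_l[OF that]]) (simp add: e mod_minus_eq)
    hence "(\<Sum>g\<in>carrier G. \<chi> g powi d * a g) = (\<Sum>g\<in>carrier G. cnj (\<sigma> (\<chi> g)) * a g)"
      by (simp add: conv[OF \<sigma>])
    thus "(\<Sum>g\<in>carrier G. \<chi> g powi d * a g) = 0"
      using vanish \<sigma>(1) by simp
  qed
qed

text \<open>The dimension is carried by the inverse map \<open>coeff_sum\<close>, which is linear on
  the whole function space, whereas linearity of \<open>trace_element\<close> is established on
  \<open>E\<close> only.\<close>

lemma dim_trace_elements: "vector_space.dim ga_rat_scale (trace_element ` E) = rat_degree E"
proof -
  interpret vector_space_pair ga_rat_scale rat_scale
    using vector_space_ga_rat_scale vector_space_rat_scale by (rule vector_space_pair.intro)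
  have lin: "Vector_Spaces.linear ga_rat_scale rat_scale coeff_sum"
    using vector_space_ga_rat_scale vector_space_rat_scale
    by (auto simp: Vector_Spaces.linear_iff coeff_sum_def ga_rat_scale_def ga_scale_def rat_scale_def
        sum.distrib sum_distrib_left algebra_simps add_divide_distrib)
  have add: "trace_element (x + y) = trace_element x + trace_element y"
    if xy: "x \<in> E" "y \<in> E" for x y
  proof
    fix g
    have "(\<Sum>\<sigma>\<in>embeddings E. \<sigma> (x + y) * cnj (\<sigma> (\<chi> g)))
        = (\<Sum>\<sigma>\<in>embeddings E. \<sigma> x * cnj (\<sigma> (\<chi> g)) + \<sigma> y * cnj (\<sigma> (\<chi> g)))"
    proof (rule sum.cong[OF refl])
      fix \<sigma> assume "\<sigma> \<in> embeddings E"
      from emb_add[OF embeddings_hom[OF this] xy]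
      show "\<sigma> (x + y) * cnj (\<sigma> (\<chi> g)) = \<sigma> x * cnj (\<sigma> (\<chi> g)) + \<sigma> y * cnj (\<sigma> (\<chi> g))"
        by (simp add: distrib_right)
    qed
    thus "trace_element (x + y) g = (trace_element x + trace_element y) g"
      using xy by (simp add: trace_element_apply rat_adjoin_add sum.distrib)
  qed
  have scale: "trace_element (of_rat c * x) = ga_rat_scale c (trace_element x)" if x: "x \<in> E" for c x
  proof
    fix g
    have "(\<Sum>\<sigma>\<in>embeddings E. \<sigma> (of_rat c * x) * cnj (\<sigma> (\<chi> g)))
        = (\<Sum>\<sigma>\<in>embeddings E. of_rat c * (\<sigma> x * cnj (\<sigma> (\<chi> g))))"
    proof (rule sum.cong[OF refl])
      fix \<sigma> assume "\<sigma> \<in> embeddings E"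
      note hom = embeddings_hom[OF this]
      show "\<sigma> (of_rat c * x) * cnj (\<sigma> (\<chi> g)) = of_rat c * (\<sigma> x * cnj (\<sigma> (\<chi> g)))"
        using emb_mult[OF hom rat_adjoin_of_rat x] emb_of_rat[OF hom] by simp
    qed
    thus "trace_element (of_rat c * x) g = ga_rat_scale c (trace_element x) g"
      using x by (simp add: trace_element_apply rat_adjoin_mult rat_adjoin_of_rat
          ga_rat_scale_def ga_scale_def sum_distrib_left)
  qed
  \<comment> \<open>Being a subspace, the image equals its span, which is where
    \<open>dim_inj_image_eq\<close> requires injectivity.\<close>
  have "vs1.subspace (trace_element ` E)"
  proof (rule vs1.subspaceI)
    have "trace_element 0 = 0"
      using scale[of 0 0] rat_adjoin_zero by (simp add: ga_rat_scale_def ga_scale_def fun_eq_iff)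
    thus "0 \<in> trace_element ` E"
      using rat_adjoin_zero by (metis image_eqI)
    show "u + v \<in> trace_element ` E" if "u \<in> trace_element ` E" "v \<in> trace_element ` E" for u v
      using that rat_adjoin_add by (auto simp flip: add)
    show "ga_rat_scale c u \<in> trace_element ` E" if "u \<in> trace_element ` E" for c u
      using that by (auto intro!: imageI rat_adjoin_mult rat_adjoin_of_rat simp flip: scale)
  qed
  hence span: "vs1.span (trace_element ` E) = trace_element ` E"
    by (simp only: vs1.span_eq_iff)
  have "inj_on coeff_sum (trace_element ` E)"
    using coeff_sum_trace_element by (auto intro!: inj_onI)
  hence "vs2.dim (coeff_sum ` trace_element ` E) = vs1.dim (trace_element ` E)"
    using dim_inj_image_eq[OF lin] by (simp only: span)
  moreover have "coeff_sum ` trace_element ` E = E"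
    using coeff_sum_trace_element by force
  ultimately show ?thesis
    by (simp add: rat_degree_def)
qed

text \<open>Generalises \<open>LR\<close> to an arbitrary finite group, with any coefficient
  function \<open>a\<close> in place of the conjugates of \<alpha>.\<close>

definition annihilated_ideal :: "('g \<Rightarrow> complex) \<Rightarrow> ('g \<Rightarrow> complex) set" where
  "annihilated_ideal a = {M \<in> rat_group_algebra G.
     M = ga_mult G M (rational_idempotent G \<chi>) \<and>
     ga_mult G M (\<Sum>g\<in>carrier G. ga_scale (a g) (ga_of (inv g))) = 0}"

text \<open>All or nothing: one nonzero \<open>s \<sigma>\<close> gives
  \<open>\<sigma> m = 0\<close>, hence \<open>m = 0\<close> by injectivity of \<sigma>.\<close>

lemma annihilated_ideal_eq:
  "annihilated_ideal a =
    (if \<forall>d::int. coprime d (int l) \<longrightarrow> (\<Sum>g\<in>carrier G. \<chi> g powi d * a g) = 0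
     then trace_element ` E else {0})"
proof -
  define s where "s = (\<lambda>\<sigma>. \<Sum>g\<in>carrier G. cnj (\<sigma> (\<chi> g)) * a g)"
  have zero: "trace_element 0 = 0"
    using emb_zero[OF embeddings_hom]
    by (auto simp: fun_eq_iff trace_element_apply[OF rat_adjoin_zero] intro!: sum.neutral)
  have "annihilated_ideal a = {M \<in> trace_element ` E.
      ga_mult G M (\<Sum>g\<in>carrier G. ga_scale (a g) (ga_of (inv g))) = 0}"
    unfolding annihilated_ideal_def rat_ideal_eq[symmetric] by auto
  also have "\<dots> = trace_element ` {m \<in> E. \<forall>\<sigma>\<in>embeddings E. \<sigma> m * s \<sigma> = 0}"
    using trace_element_annihilates_iff by (auto simp: s_def)
  also have "{m \<in> E. \<forall>\<sigma>\<in>embeddings E. \<sigma> m * s \<sigma> = 0}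
      = (if \<forall>\<sigma>\<in>embeddings E. s \<sigma> = 0 then E else {0})"
  proof (cases "\<forall>\<sigma>\<in>embeddings E. s \<sigma> = 0")
    case False
    then obtain \<sigma> where \<sigma>: "\<sigma> \<in> embeddings E" "s \<sigma> \<noteq> 0"
      by blast
    have "m = 0" if "m \<in> E" "\<forall>\<sigma>\<in>embeddings E. \<sigma> m * s \<sigma> = 0" for m
      using that \<sigma> emb_eq_0_iff[OF embeddings_hom[OF \<sigma>(1)]] by auto
    moreover have "\<sigma> 0 * s \<sigma> = 0" if "\<sigma> \<in> embeddings E" for \<sigma>
      using emb_zero[OF embeddings_hom[OF that]] by simp
    ultimately show ?thesis
      using False rat_adjoin_zero by auto
  qed simp
  finally show ?thesis
    unfolding conj_sums_vanish_iff[symmetric] s_def by (auto simp: zero)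
qed

text \<open>Keeps the two branches of \<open>annihilated_ideal_eq\<close> apart, so that a nonzero
  ideal detects the vanishing condition. The witness is \<open>trace_element 1\<close>, which
  \<open>coeff_sum\<close> sends to 1.\<close>

lemma trace_elements_nontrivial: "trace_element ` E \<noteq> {0}"
proof
  assume "trace_element ` E = {0}"
  hence "trace_element 1 = 0"
    using rat_adjoin_one[of "{\<zeta>}"] by blast
  hence "coeff_sum 0 = 1"
    using coeff_sum_trace_element[OF rat_adjoin_one] by simp
  thus False
    by (simp add: coeff_sum_def)
qed

end

section \<open>The Galois group\<close>

lemma carrier_Gal_rat_adjoin:
  "carrier (Gal (rat_adjoin S) \<rat>) = {\<sigma> \<in> embeddings (rat_adjoin S). bij_betw \<sigma> (rat_adjoin S) (rat_adjoin S)}"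
  by (auto simp: carrier_Gal emb_rat[OF embeddings_hom])

lemma group_Gal_rat_adjoin: "group (Gal (rat_adjoin S) \<rat>)"
proof -
  define K where "K = rat_adjoin S"
  define H where "H = carrier (Gal K \<rat>)"
  have H: "\<sigma> \<in> H \<longleftrightarrow> \<sigma> \<in> Bij K \<and> \<sigma> \<in> Ring.ring_hom (subring_of K) class_ring" for \<sigma>
    by (auto simp: H_def K_def carrier_Gal_rat_adjoin embeddings_def Bij_def)
  have K: "1 \<in> K" "x \<in> K \<Longrightarrow> y \<in> K \<Longrightarrow> x + y \<in> K" "x \<in> K \<Longrightarrow> y \<in> K \<Longrightarrow> x * y \<in> K" for x y
    by (simp_all add: K_def rat_adjoin_one rat_adjoin_add rat_adjoin_mult)
  have "subgroup H (BijGroup K)"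
  proof (rule subgroup.intro)
    show "H \<subseteq> carrier (BijGroup K)"
      by (auto simp: H BijGroup_def)
  next
    fix \<sigma> \<tau> assume \<sigma>: "\<sigma> \<in> H" and \<tau>: "\<tau> \<in> H"
    have "compose K \<sigma> \<tau> \<in> Bij K"
      using \<sigma> \<tau> by (simp add: H compose_Bij)
    moreover have "\<tau> x \<in> K" if "x \<in> K" for x
      using \<tau> that Bij_imp_funcset by (fastforce simp: H)
    hence "compose K \<sigma> \<tau> \<in> Ring.ring_hom (subring_of K) class_ring"
      using \<sigma> \<tau> K by (simp add: H subring_of_hom_iff compose_eq)
    ultimately show "\<sigma> \<otimes>\<^bsub>BijGroup K\<^esub> \<tau> \<in> H"
      using \<sigma> \<tau> by (simp add: H BijGroup_def)
  next
    show "\<one>\<^bsub>BijGroup K\<^esub> \<in> H"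
      using K by (simp add: H BijGroup_def id_Bij subring_of_hom_iff)
  next
    fix \<sigma> assume \<sigma>: "\<sigma> \<in> H"
    hence bij: "\<sigma> \<in> Bij K"
      by (simp add: H)
    have "inv_into K \<sigma> (x * y) = inv_into K \<sigma> x * inv_into K \<sigma> y"
      "inv_into K \<sigma> (x + y) = inv_into K \<sigma> x + inv_into K \<sigma> y" if "x \<in> K" "y \<in> K" for x y
      using \<sigma> K that by (auto simp: H subring_of_hom_iff intro!: Bij_inv_into_lemma[OF _ bij])
    moreover have "inv_into K \<sigma> 1 = 1"
    proof -
      have "inj_on \<sigma> K" "\<sigma> 1 = 1"
        using \<sigma> by (auto simp: H Bij_def bij_betw_def subring_of_hom_iff)
      thus ?thesis
        using inv_into_f_f[of \<sigma> K 1] K(1) by simp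
    qed
    ultimately have "(\<lambda>x\<in>K. inv_into K \<sigma> x) \<in> Ring.ring_hom (subring_of K) class_ring"
      using K by (simp add: subring_of_hom_iff)
    thus "inv\<^bsub>BijGroup K\<^esub> \<sigma> \<in> H"
      using bij by (simp add: H inv_BijGroup restrict_inv_into_Bij)
  qed
  hence "group (BijGroup K\<lparr>carrier := H\<rparr>)"
    using group_BijGroup by (rule subgroup.subgroup_is_group)
  moreover have "BijGroup K\<lparr>carrier := H\<rparr> = Gal K \<rat>"
    by (simp add: H_def Gal_def)
  ultimately show ?thesis
    by (simp add: K_def)
qed

text \<open>An automorphism is determined by the image of the generator \<alpha>, which is one of
  the finitely many roots of \<open>p\<close>.\<close>

lemma finite_Gal_rat_adjoin:
  assumes "p \<noteq> 0" "poly (map_poly of_rat p) \<alpha> = 0"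
  shows "finite (carrier (Gal (rat_adjoin {\<alpha>}) \<rat>))"
proof (rule inj_on_finite)
  have mem: "\<alpha> \<in> rat_adjoin {\<alpha>}"
    by (simp add: rat_adjoin_incl)
  show "inj_on (\<lambda>\<sigma>. \<sigma> \<alpha>) (carrier (Gal (rat_adjoin {\<alpha>}) \<rat>))"
    by (auto simp: carrier_Gal_rat_adjoin intro!: inj_onI embeddings_eqI[of _ "{\<alpha>}"])
  show "(\<lambda>\<sigma>. \<sigma> \<alpha>) ` carrier (Gal (rat_adjoin {\<alpha>}) \<rat>) \<subseteq> {z. poly (map_poly of_rat p) z = 0}"
  proof safe
    fix \<sigma> assume "\<sigma> \<in> carrier (Gal (rat_adjoin {\<alpha>}) \<rat>)"
    hence hom: "\<sigma> \<in> Ring.ring_hom (subring_of (rat_adjoin {\<alpha>})) class_ring"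
      by (simp add: carrier_Gal_rat_adjoin embeddings_def)
    show "poly (map_poly of_rat p) (\<sigma> \<alpha>) = 0"
      using emb_poly[OF hom mem, of p] assms(2) emb_zero[OF hom] by simp
  qed
  show "finite {z. poly (map_poly of_rat p) z = (0 :: complex)}"
    using assms(1) by (intro poly_roots_finite) simp
qed

theorem theorem3p1:
  fixes f :: "int poly" and \<alpha> \<zeta> :: complex and l :: nat
    and G :: "(complex \<Rightarrow> complex) monoid"
    and \<chi> :: "(complex \<Rightarrow> complex) \<Rightarrow> complex"
  assumes "lead_coeff f = 1" and "irreducible f"
    and "poly (map_poly of_int f) \<alpha> = 0"
    and "galois_over_rat (rat_adjoin {\<alpha>})"
    and "G = Gal (rat_adjoin {\<alpha>}) \<rat>"
    and "irreducible_character G \<chi>" and "\<chi> \<one>\<^bsub>G\<^esub> = 1"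
    and "l = char_order G \<chi>"
    and "primitive_root_of_unity l \<zeta>"
  shows "char_field G \<chi> = rat_adjoin {\<zeta>} \<and>
    (LR G \<alpha> \<chi> \<noteq> {0} \<longleftrightarrow>
       (\<forall>d::int. coprime d (int l) \<longrightarrow> (\<Sum>g\<in>carrier G. \<chi> g powi d * g \<alpha>) = 0)) \<and>
    (LR G \<alpha> \<chi> \<noteq> {0} \<longrightarrow>
       LR G \<alpha> \<chi> =
         {(\<Sum>g\<in>carrier G. ga_scale (field_trace (rat_adjoin {\<zeta>}) (m * cnj (\<chi> g))) (ga_of g))
          | m. m \<in> rat_adjoin {\<zeta>}} \<and>
       vector_space.dim ga_rat_scale (LR G \<alpha> \<chi>) = rat_degree (rat_adjoin {\<zeta>}))"
proof -
  \<comment> \<open>Read over the rationals, \<open>f\<close> is the nonzero polynomial whose roots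
    bound the size of \<open>G\<close>.\<close>
  have "poly (map_poly of_rat (of_int_poly f)) \<alpha> = 0"
    using assms(3) by (simp add: map_poly_map_poly o_def)
  moreover have "of_int_poly f \<noteq> (0 :: rat poly)"
    using assms(1) by auto
  ultimately have fin: "finite (carrier G)"
    using finite_Gal_rat_adjoin assms(5) by blast
  have grp: "group G"
    using group_Gal_rat_adjoin assms(5) by blast
  interpret group G
    by (rule grp)
  have "linear_character G \<chi>"
    by (rule irreducible_character_linear) (fact grp assms)+
  then interpret linear_character_group G \<chi> l \<zeta>
    using fin assms(8,9) by unfold_locales
  have LR: "LR G \<alpha> \<chi> = annihilated_ideal (\<lambda>g. g \<alpha>)"
    by (simp add: LR_def annihilated_ideal_def)
  have "trace_element ` rat_adjoin {\<zeta>} =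
      {(\<Sum>g\<in>carrier G. ga_scale (field_trace (rat_adjoin {\<zeta>}) (m * cnj (\<chi> g))) (ga_of g))
        | m. m \<in> rat_adjoin {\<zeta>}}"
    by (auto simp: trace_element_def)
  thus ?thesis
    using char_field_eq annihilated_ideal_eq[of "\<lambda>g. g \<alpha>"] trace_elements_nontrivial dim_trace_elements
    unfolding LR by (simp split: if_splits)
qed

end
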